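(* Let $F\in\mathfrak N_n^+(\mathbb D)$, put $F_\lambda:=F-\lambda I_n$ for $\lambda\in\mathbb C$, and let $M_F:=\{\lambda\in\mathbb C:\det(F_\lambda)\equiv 0 \text{ in }\mathbb D\}$. Assume that for each $\lambda\in\mathbb C\setminus M_F$ the functions $\Theta_{\lambda,r}\in\mathfrak I_n(\mathbb D)$ (inner) and $E_{\lambda,r}\in\mathfrak E_n(\mathbb D)$ (outer) are factors in the multiplicative decomposition $$F_\lambda=\Theta_{\lambda,r}\cdot E_{\lambda,r}.$$ Suppose that $K$ is a bounded Borel subset of $\mathbb C$ with positive logarithmic capacity. Then there exists a point $\lambda\in K\cap(\mathbb C\setminus M_F)$ for which $\Theta_{\lambda,r}$ is a Blaschke-Potapov product.
   Context: $\mathbb D$ is the open unit disc, $\mathbb T$ the unit circle, $m$ normalized Lebesgue measure on $\mathbb T$, $\mathfrak M_n$ the complex $n\times n$ matrices with the operator norm induced by the Euclidean norm. Smirnov class: $\mathfrak N_n^+(\mathbb D)$ is the set of holomorphic $F:\mathbb D\to\mathfrak M_n$ such that for each $\epsilon>0$ there is $\delta>0$ with $\int_\Delta \ln^+\|F(rt)\|\,m(dt)<\epsilon$ for all $r\in[0,1)$ and all Borel $\Delta\subseteq\mathbb T$ with $m(\Delta)<\delta$. Such $F$ has radial boundary values $\underline F(t)=\lim_{r\to1-0}F(rt)$ for $m$-a.e. $t$. Outer: a scalar function $e:\mathbb D\to\mathbb C$ is outer if $e(z)=C\exp\{\int_{\mathbb T}\frac{t+z}{t-z}\ln[w(t)]\,m(dt)\}$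 with $|C|=1$ and $w:\mathbb T\to[0,\infty)$ such that $\ln w$ is $m$-integrable. $\mathfrak E_n(\mathbb D)$ is the set of $E\in\mathfrak N_n^+(\mathbb D)$ with $\det E$ outer. Inner: $\mathfrak I_n(\mathbb D)$ is the set of holomorphic $\Theta:\mathbb D\to\mathfrak M_n$ with $\|\Theta(z)\|\le1$ on $\mathbb D$ and $\underline\Theta(t)$ unitary for $m$-a.e. $t$. Blaschke-Potapov products: for $a\in\mathbb D$ let $b_a(z)=\frac{|a|}{a}\frac{a-z}{1-\overline a z}$ if $a\ne0$ and $b_0(z)=z$; for a non-zero orthogonal projection matrix $P$ let $B_{a,P}(z)=I_n+[b_a(z)-1]P$. A left (resp. right) Blaschke-Potapov product is a constant function with unitary value, or a function of the form $\big(B_{z_1,P_1}B_{z_2,P_2}\cdots\big)V$ (resp. $V\big(\cdots B_{z_2,P_2}B_{z_1,P_1}\big)$), a finite or infinite product with $V$ unitary, $z_k\in\mathbb D$, $P_k$ non-zero orthogonal projection matrices and $\sum_k(1-|z_k|)\,\mathrm{tr}\,P_k<\infty$ (under this condition the products converge on $\mathbb D$). The left and right Blaschke-Potapov products form the same class, so one speaks simply of a Blaschke-Potapov product. Capacity: for a finite nonnegative Borel measure $\nu$ on $\mathbb C$ with compact support, its logarithmic potential is $U^{(\nu)}(\xi)=\int_{\mathbb C}\ln|\xi-\lambda|\,\nu(d\lambda)$. A bounded Borel set $K\subset\mathbb C$ is said to have positive logarithmic capacity if there is a nonzero finite nonnegative Borel measure $\nu$ with $\nu(\mathbb C\setminus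 K)=0$ for which $U^{(\nu)}$ is a (finite real-valued) continuous function on $\mathbb C$. *)

theory Defs
  imports "HOL-Complex_Analysis.Complex_Analysis"
begin

abbreviation unit_disc :: "complex set" where
  "unit_disc \<equiv> ball 0 1"

abbreviation unit_circle :: "complex set" where
  "unit_circle \<equiv> sphere 0 1"

text \<open>Normalized Lebesgue measure on the circle: the push-forward of the uniform
  distribution on \<open>[0, 2\<pi>)\<close>. Its space is the circle itself and its measurable sets
  are the Borel subsets of the circle.\<close>

definition circle_measure :: "complex measure" where
  "circle_measure =
     distr (uniform_measure lborel {0..<2 * pi}) (restrict_space borel unit_circle) cis"

text \<open>The vector norm on \<open>complex ^ 'n\<close> is the Euclidean one, so this is the operator
  norm induced by it.\<close>

definition opnorm :: "complex ^ 'n ^ 'n \<Rightarrow> real" where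
  "opnorm A = onorm (\<lambda>x. A *v x)"

definition adjoint_matrix :: "complex ^ 'n ^ 'n \<Rightarrow> complex ^ 'n ^ 'n" where
  "adjoint_matrix A = (\<chi> i j. cnj (A $ j $ i))"

definition unitary_matrix :: "complex ^ 'n ^ 'n \<Rightarrow> bool" where
  "unitary_matrix U \<longleftrightarrow> adjoint_matrix U ** U = mat 1 \<and> U ** adjoint_matrix U = mat 1"

definition orthogonal_projection_matrix :: "complex ^ 'n ^ 'n \<Rightarrow> bool" where
  "orthogonal_projection_matrix P \<longleftrightarrow> P ** P = P \<and> adjoint_matrix P = P"

definition matrix_holomorphic_on ::
    "(complex \<Rightarrow> complex ^ 'n ^ 'n) \<Rightarrow> complex set \<Rightarrow> bool" where
  "matrix_holomorphic_on F S \<longleftrightarrow> (\<forall>i j. (\<lambda>z. F z $ i $ j) holomorphic_on S)"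

text \<open>Functions on the disc are represented by total functions; only their values on
  \<open>unit_disc\<close> are ever used. The expression \<open>ln (max 1 x)\<close> is \<open>ln\<^sup>+ x\<close>.\<close>

definition smirnov_class :: "(complex \<Rightarrow> complex ^ 'n ^ 'n) set" where
  "smirnov_class = {F. matrix_holomorphic_on F unit_disc \<and>
     (\<forall>\<epsilon>>0. \<exists>\<delta>>0. \<forall>r::real. \<forall>\<Delta>\<in>sets circle_measure.
        0 \<le> r \<and> r < 1 \<and> measure circle_measure \<Delta> < \<delta> \<longrightarrow>
        (LINT t:\<Delta>|circle_measure. ln (max 1 (opnorm (F (of_real r * t))))) < \<epsilon>)}"

text \<open>Since \<open>ln 0 = 0\<close> in HOL, integrability of \<open>ln w\<close> in the usual sense (with
  \<open>ln 0 = -\<infinity>\<close>) is integrability of the HOL function together with \<open>w > 0\<close> almost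
  everywhere.\<close>

definition scalar_outer :: "(complex \<Rightarrow> complex) \<Rightarrow> bool" where
  "scalar_outer e \<longleftrightarrow>
     (\<exists>(C::complex) (w::complex \<Rightarrow> real).
        cmod C = 1 \<and>
        w \<in> borel_measurable circle_measure \<and>
        (\<forall>t\<in>unit_circle. 0 \<le> w t) \<and>
        (AE t in circle_measure. 0 < w t) \<and>
        integrable circle_measure (\<lambda>t. ln (w t)) \<and>
        (\<forall>z\<in>unit_disc.
           e z = C * exp (LINT t|circle_measure. (t + z) / (t - z) * of_real (ln (w t)))))"

definition outer_class :: "(complex \<Rightarrow> complex ^ 'n ^ 'n) set" where
  "outer_class = {E \<in> smirnov_class. scalar_outer (\<lambda>z. det (E z))}"

definition inner_class :: "(complex \<Rightarrow> complex ^ 'n ^ 'n) set" where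
  "inner_class = {\<Theta>. matrix_holomorphic_on \<Theta> unit_disc \<and>
     (\<forall>z\<in>unit_disc. opnorm (\<Theta> z) \<le> 1) \<and>
     (AE t in circle_measure. \<exists>U. unitary_matrix U \<and>
        ((\<lambda>r::real. \<Theta> (of_real r * t)) \<longlongrightarrow> U) (at_left 1))}"

definition blaschke_factor :: "complex \<Rightarrow> complex \<Rightarrow> complex" where
  "blaschke_factor a z =
     (if a = 0 then z else of_real (cmod a) / a * ((a - z) / (1 - cnj a * z)))"

definition bp_factor :: "complex \<Rightarrow> complex ^ 'n ^ 'n \<Rightarrow> complex \<Rightarrow> complex ^ 'n ^ 'n" where
  "bp_factor a P z = (\<chi> i j. mat 1 $ i $ j + (blaschke_factor a z - 1) * P $ i $ j)"

primrec left_bp_partial ::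
    "(nat \<Rightarrow> complex) \<Rightarrow> (nat \<Rightarrow> complex ^ 'n ^ 'n) \<Rightarrow> nat \<Rightarrow> complex \<Rightarrow> complex ^ 'n ^ 'n" where
  "left_bp_partial a P 0 z = mat 1"
| "left_bp_partial a P (Suc N) z = left_bp_partial a P N z ** bp_factor (a N) (P N) z"

primrec right_bp_partial ::
    "(nat \<Rightarrow> complex) \<Rightarrow> (nat \<Rightarrow> complex ^ 'n ^ 'n) \<Rightarrow> nat \<Rightarrow> complex \<Rightarrow> complex ^ 'n ^ 'n" where
  "right_bp_partial a P 0 z = mat 1"
| "right_bp_partial a P (Suc N) z = bp_factor (a N) (P N) z ** right_bp_partial a P N z"

definition bp_data :: "complex \<Rightarrow> complex ^ 'n ^ 'n \<Rightarrow> bool" where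
  "bp_data a P \<longleftrightarrow> a \<in> unit_disc \<and> P \<noteq> 0 \<and> orthogonal_projection_matrix P"

text \<open>In the next two definitions the first disjunct with \<open>N = 0\<close> gives the constant
  functions with unitary value.\<close>

definition left_blaschke_potapov :: "(complex \<Rightarrow> complex ^ 'n ^ 'n) \<Rightarrow> bool" where
  "left_blaschke_potapov B \<longleftrightarrow>
     (\<exists>V a P. unitary_matrix V \<and>
        ((\<exists>N. (\<forall>k<N. bp_data (a k) (P k)) \<and>
              (\<forall>z\<in>unit_disc. B z = left_bp_partial a P N z ** V)) \<or>
         ((\<forall>k. bp_data (a k) (P k)) \<and>
          summable (\<lambda>k. of_real (1 - cmod (a k)) * trace (P k)) \<and>
          (\<forall>z\<in>unit_disc. (\<lambda>N. left_bp_partial a P N z ** V) \<longlonglongrightarrow> B z))))"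

definition right_blaschke_potapov :: "(complex \<Rightarrow> complex ^ 'n ^ 'n) \<Rightarrow> bool" where
  "right_blaschke_potapov B \<longleftrightarrow>
     (\<exists>V a P. unitary_matrix V \<and>
        ((\<exists>N. (\<forall>k<N. bp_data (a k) (P k)) \<and>
              (\<forall>z\<in>unit_disc. B z = V ** right_bp_partial a P N z)) \<or>
         ((\<forall>k. bp_data (a k) (P k)) \<and>
          summable (\<lambda>k. of_real (1 - cmod (a k)) * trace (P k)) \<and>
          (\<forall>z\<in>unit_disc. (\<lambda>N. V ** right_bp_partial a P N z) \<longlonglongrightarrow> B z))))"

text \<open>The left and the right products form the same class.\<close>

definition blaschke_potapov :: "(complex \<Rightarrow> complex ^ 'n ^ 'n) \<Rightarrow> bool" where
  "blaschke_potapov B \<longleftrightarrow> left_blaschke_potapov B \<or> right_blaschke_potapov B"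

definition log_potential :: "complex measure \<Rightarrow> complex \<Rightarrow> real" where
  "log_potential \<nu> \<xi> = (LINT c|\<nu>. ln (cmod (\<xi> - c)))"

text \<open>\<open>log_potential\<close> is the usual potential (in which \<open>ln 0 = -\<infinity>\<close>) exactly where the
  latter is finite. For a compactly supported finite measure this means that \<open>\<xi>\<close> carries
  no mass and that the HOL integrand is integrable.\<close>

definition finite_log_potential_at :: "complex measure \<Rightarrow> complex \<Rightarrow> bool" where
  "finite_log_potential_at \<nu> \<xi> \<longleftrightarrow>
     emeasure \<nu> {\<xi>} = 0 \<and> integrable \<nu> (\<lambda>c. ln (cmod (\<xi> - c)))"

text \<open>To be used for bounded Borel sets \<open>K\<close>; a measure that vanishes off such a set
  has compact support.\<close>

definition positive_log_capacity :: "complex set \<Rightarrow> bool" where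
  "positive_log_capacity K \<longleftrightarrow>
     (\<exists>\<nu>::complex measure. sets \<nu> = sets borel \<and> finite_measure \<nu> \<and>
        emeasure \<nu> UNIV \<noteq> 0 \<and> emeasure \<nu> (- K) = 0 \<and>
        (\<forall>\<xi>. finite_log_potential_at \<nu> \<xi>) \<and>
        continuous_on UNIV (log_potential \<nu>))"

text \<open>\<open>mat c\<close> is the scalar matrix \<open>c I\<close>.\<close>

definition shifted ::
    "(complex \<Rightarrow> complex ^ 'n ^ 'n) \<Rightarrow> complex \<Rightarrow> complex \<Rightarrow> complex ^ 'n ^ 'n" where
  "shifted F c z = F z - mat c"

definition exceptional_set :: "(complex \<Rightarrow> complex ^ 'n ^ 'n) \<Rightarrow> complex set" where
  "exceptional_set F = {c. \<forall>z\<in>unit_disc. det (shifted F c z) = 0}"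

end

theory Submission
  imports Defs "HOL-Computational_Algebra.Fundamental_Theorem_Algebra"
begin

text \<open>
  Let \<open>f\<^sub>c = det (F - c)\<close>. Since \<open>F - c = \<Theta>\<^sub>c E\<^sub>c\<close>, the function \<open>ln \<bar>f\<^sub>c\<bar> - ln \<bar>det \<Theta>\<^sub>c\<bar>\<close> is the Poisson
  integral of an integrable function, and \<open>\<bar>det \<Theta>\<^sub>c\<bar>\<close> has radial limits \<open>1\<close> almost everywhere. Hence the
  circle means of \<open>ln \<bar>det \<Theta>\<^sub>c\<bar>\<close> can stay away from \<open>0\<close> only if \<open>ln \<bar>f\<^sub>c\<bar>\<close> carries a definite negative
  mass near its zeros. Averaged over \<open>c\<close> against a measure with continuous potential, this negative
  mass is uniformly small: \<open>f\<^sub>c(z)\<close> is the product of the factors \<open>\<lambda> - c\<close> over the eigenvalues of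
  \<open>F(z)\<close>, and the truncated potentials converge uniformly by Dini's theorem. So for almost every \<open>c\<close>
  the means of \<open>ln \<bar>det \<Theta>\<^sub>c\<bar>\<close> come arbitrarily close to \<open>0\<close> (Frostman's argument).

  For such \<open>c\<close> one splits off Blaschke--Potapov factors at the zeros of \<open>det \<Theta>\<^sub>c\<close> in order of increasing
  modulus. By the mean value property the determinants at the origin of the remaining contractive
  functions tend to \<open>1\<close> in modulus, which by the Schwarz--Pick inequality forces these functions to
  converge to a unitary constant.
\<close>

section \<open>Contractive matrices\<close>

text \<open>The obstacle: unimodular boundary values of \<open>det \<Theta>\<close> do not control
  the means of \<open>ln |det \<Theta>|\<close>; for a nonconstant scalar singular inner function
  these stay at a fixed negative value. With \<open>\<theta> = |det \<Theta>|\<close>,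
  \<open>y = |det E|\<close> and \<open>x = \<theta> y\<close> one writes \<open>ln (1/\<theta>) = M
  + ln (\<delta>/x) + ln (y/(\<delta> exp M))\<close>. Truncation at \<open>M\<close> lets dominated
  convergence exploit the boundary values, the potential controls the second term, and outerness
  makes the third small uniformly in the radius. One chooses \<delta>, then \<open>M\<close>, then
  the radius. Fatou's lemma makes the second term small only for infinitely many radii of a
  sequence, which is enough because the other two are small for all large ones.

  The remaining question is how scalar determinants can control matrices. For a contraction
  \<open>A\<close> and a unit vector \<open>x\<close>, \<open>|det A| \<le> |A x|\<close>, so a
  determinant of modulus near 1 makes \<open>A\<close> nearly isometric in every direction. Zeros
  are taken by increasing modulus so that each remainder has a zero-free disc, on which the value at
  0 is a circle mean.\<close>

definition cinner :: "complex ^ 'n \<Rightarrow> complex ^ 'n \<Rightarrow> complex" where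
  "cinner x y = (\<Sum>i\<in>UNIV. x $ i * cnj (y $ i))"

lemma cinner_add_left: "cinner (x + y) z = cinner x z + cinner y z"
  by (simp add: cinner_def sum.distrib algebra_simps)

lemma cinner_diff_right: "cinner z (x - y) = cinner z x - cinner z y"
  by (simp add: cinner_def sum_subtractf algebra_simps)

lemma cinner_scale_left: "cinner (c *s x) y = c * cinner x y"
  by (simp add: cinner_def sum_distrib_left algebra_simps)

lemma cinner_scale_right: "cinner x (c *s y) = cnj c * cinner x y"
  by (simp add: cinner_def sum_distrib_left algebra_simps)

text \<open>Bridge between the Hermitian form and the real inner product on
  \<open>complex ^ 'n\<close>: norm identities can be proved on the real side.\<close>

lemma Re_cinner: "Re (cinner x y) = x \<bullet> y"
  by (simp add: cinner_def inner_vec_def inner_complex_def)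

lemma cinner_self: "cinner x x = of_real ((norm x)\<^sup>2)"
proof -
  have "Im (cinner x x) = 0"
    by (simp add: cinner_def Im_sum)
  then show ?thesis
    by (simp add: complex_eq_iff Re_cinner power2_norm_eq_inner)
qed

lemma cinner_adjoint: "cinner (A *v x) y = cinner x (adjoint_matrix A *v y)"
proof -
  have "cinner (A *v x) y = (\<Sum>i\<in>UNIV. \<Sum>j\<in>UNIV. A $ i $ j * x $ j * cnj (y $ i))"
    by (simp add: cinner_def matrix_vector_mult_def sum_distrib_right)
  also have "\<dots> = (\<Sum>j\<in>UNIV. \<Sum>i\<in>UNIV. A $ i $ j * x $ j * cnj (y $ i))"
    by (rule sum.swap)
  also have "\<dots> = cinner x (adjoint_matrix A *v y)"
    by (simp add: cinner_def matrix_vector_mult_def adjoint_matrix_def sum_distrib_left algebra_simps)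
  finally show ?thesis .
qed

lemma norm_cscale: "norm (c *s (x :: complex ^ 'n)) = cmod c * norm x"
  by (simp add: norm_vec_def L2_set_def norm_mult power_mult_distrib real_sqrt_mult flip: sum_distrib_left)

lemma cmod_cinner_le: "cmod (cinner x y) \<le> norm x * norm y"
proof -
  \<comment> \<open>A unimodular \<open>c\<close> rotates \<open>cinner x y\<close> onto the
    nonnegative real axis, which reduces the claim to the real Cauchy-Schwarz inequality.\<close>
  define c where "c = (if cinner x y = 0 then 1 else cnj (cinner x y) / of_real (cmod (cinner x y)))"
  have c: "cmod c = 1" by (simp add: c_def norm_divide)
  have "c * cinner x y = of_real (cmod (cinner x y))"
    by (auto simp: c_def complex_norm_square[symmetric] power2_eq_square mult.commute)
  then have "cmod (cinner x y) = Re (cinner (c *s x) y)"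
    by (simp add: cinner_scale_left)
  also have "\<dots> \<le> norm (c *s x) * norm y"
    by (simp add: Re_cinner norm_cauchy_schwarz)
  finally show ?thesis by (simp add: norm_cscale c)
qed

lemma norm_add_square: "(norm (x + y :: complex ^ 'n))\<^sup>2 = (norm x)\<^sup>2 + 2 * Re (cinner x y) + (norm y)\<^sup>2"
  by (simp add: Re_cinner power2_norm_eq_inner inner_add_left inner_add_right inner_commute)

lemma norm_diff_square: "(norm (x - y :: complex ^ 'n))\<^sup>2 = (norm x)\<^sup>2 - 2 * Re (cinner x y) + (norm y)\<^sup>2"
  by (simp add: Re_cinner power2_norm_eq_inner inner_diff_left inner_diff_right inner_commute)

definition contractive :: "complex ^ 'n ^ 'n \<Rightarrow> bool" where
  "contractive A \<longleftrightarrow> (\<forall>x. norm (A *v x) \<le> norm x)"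

lemma contractiveD: "contractive A \<Longrightarrow> norm (A *v x) \<le> norm x"
  by (simp add: contractive_def)

lemma opnorm_contractive: "opnorm A \<le> 1 \<Longrightarrow> contractive A"
  unfolding contractive_def
proof
  fix x assume A: "opnorm A \<le> 1"
  have "norm (A *v x) \<le> opnorm A * norm x"
    unfolding opnorm_def by (rule onorm) simp
  also have "\<dots> \<le> 1 * norm x" using A by (intro mult_right_mono) auto
  finally show "norm (A *v x) \<le> norm x" by simp
qed

lemma contractive_mult: "contractive A \<Longrightarrow> contractive B \<Longrightarrow> contractive (A ** B)"
  unfolding contractive_def by (metis matrix_vector_mul_assoc order_trans)

lemma contractive_mat_1: "contractive (mat 1)"
  by (simp add: contractive_def)

lemma norm_axis_unit: "norm (axis i 1 :: complex ^ 'n) = 1"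
  by (simp add: norm_vec_def L2_set_def axis_def if_distrib[of "\<lambda>x. (norm x)\<^sup>2"] cong: if_cong)

lemma contractive_entry:
  fixes A :: "complex ^ 'n ^ 'n"
  assumes "contractive A" shows "cmod (A $ i $ j) \<le> 1"
proof -
  have "cmod (A $ i $ j) = cmod ((A *v axis j 1) $ i)"
    by (simp add: matrix_vector_mult_def axis_def if_distrib[of "\<lambda>x. _ * x"] cong: if_cong)
  also have "\<dots> \<le> norm (A *v axis j 1)" by (rule Finite_Cartesian_Product.norm_nth_le)
  also have "\<dots> \<le> norm (axis j (1::complex))" by (rule contractiveD[OF assms])
  also have "\<dots> = 1" by (simp add: norm_axis_unit)
  finally show ?thesis .
qed

lemma det_0_kernel:
  fixes A :: "complex ^ 'n ^ 'n"
  shows "det A = 0 \<longleftrightarrow> (\<exists>x. norm x = 1 \<and> A *v x = 0)"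
proof
  assume "det A = 0"
  then obtain x where x: "x \<noteq> 0" "A *v x = 0"
    using invertible_det_nz invertible_left_inverse matrix_left_invertible_ker by metis
  have "A *v (of_real (inverse (norm x)) *s x) = 0"
    using x by (simp add: vector_scalar_commute flip: matrix_vector_mult_scaleR)
  moreover have "norm (complex_of_real (inverse (norm x)) *s x) = 1"
    using x by (simp add: norm_cscale norm_inverse del: of_real_inverse)
  ultimately show "\<exists>x. norm x = 1 \<and> A *v x = 0" by blast
next
  assume "\<exists>x. norm x = 1 \<and> A *v x = 0"
  then show "det A = 0"
    using invertible_det_nz invertible_left_inverse matrix_left_invertible_ker
    by (metis norm_zero zero_neq_one)
qed

section \<open>Eigenvalues with multiplicity\<close>

lemma mat_mult_vec: "mat c *v x = c *s (x :: complex ^ 'n)"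
  by (simp add: vec_eq_iff matrix_vector_mult_def mat_def if_distrib[of "\<lambda>x. x * _"] cong: if_cong)

text \<open>In the Leibniz sum, a polynomial in \<open>c\<close>, each term has degree at most the
  number of fixed points of its permutation; only the identity reaches the dimension
  \<open>n\<close>, with leading coefficient \<open>(-1)^n\<close>. The roots are the eigenvalues,
  and they later turn \<open>ln |det (A - c)|\<close> into a sum of logarithmic kernels.\<close>

lemma det_shift_factorization:
  fixes A :: "complex ^ 'n ^ 'n"
  obtains M :: "complex multiset" where "size M = CARD('n)"
    and "\<And>c. det (A - mat c) = (\<Prod>x\<in>#M. x - c)"
proof -
  let ?n = "CARD('n)"
  define e :: "'n \<Rightarrow> 'n \<Rightarrow> complex poly" where
    "e i j = [:A $ i $ j, if i = j then -1 else 0:]" for i j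
  define q where "q = (\<Sum>p | p permutes (UNIV::'n set). of_int (sign p) * (\<Prod>i\<in>UNIV. e i (p i)))"
  have poly_q: "poly q c = det (A - mat c)" for c
    unfolding q_def det_def poly_sum poly_mult poly_prod
    by (intro sum.cong refl arg_cong2[where f="(*)"] prod.cong) (auto simp: e_def mat_def)
  have dege: "degree (e i j) \<le> (if i = j then 1 else 0)" for i j
    by (simp add: e_def)
  have degp: "degree (of_int (sign p) * (\<Prod>i\<in>UNIV. e i (p i))) \<le> card {i. p i = i}" for p
  proof -
    have "degree (of_int (sign p) * (\<Prod>i\<in>UNIV. e i (p i))) \<le> degree (\<Prod>i\<in>UNIV. e i (p i))"
      by (rule order_trans[OF degree_mult_le]) (simp add: degree_of_int)
    also have "\<dots> \<le> (\<Sum>i\<in>UNIV. degree (e i (p i)))"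
      by (rule order_trans[OF degree_prod_sum_le]) (auto simp: o_def)
    also have "\<dots> \<le> (\<Sum>i\<in>UNIV. if i = p i then 1 else 0)"
      by (intro sum_mono dege)
    also have "\<dots> = card {i. p i = i}"
      by (simp add: sum.If_cases eq_commute)
    finally show ?thesis .
  qed
  have "degree q \<le> ?n"
    unfolding q_def
    by (intro degree_sum_le) (auto intro!: order_trans[OF degp] card_mono)
  have coeff_id: "coeff (\<Prod>i\<in>UNIV. e i i) ?n = (-1) ^ ?n"
  proof -
    have nz: "e i i \<noteq> 0" for i by (simp add: e_def)
    have "degree (\<Prod>i\<in>UNIV. e i i) = (\<Sum>i\<in>(UNIV::'n set). degree (e i i))"
      by (rule degree_prod_eq_sum_degree) (simp add: nz)
    also have "\<dots> = ?n" by (simp add: e_def)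
    finally have "coeff (\<Prod>i\<in>UNIV. e i i) ?n = lead_coeff (\<Prod>i\<in>UNIV. e i i)" by simp
    also have "\<dots> = (\<Prod>i\<in>(UNIV::'n set). lead_coeff (e i i))" by (simp add: lead_coeff_prod)
    also have "\<dots> = (-1) ^ ?n" by (simp add: e_def)
    finally show ?thesis .
  qed
  have "coeff q ?n = (\<Sum>p | p permutes (UNIV::'n set). coeff (of_int (sign p) * (\<Prod>i\<in>UNIV. e i (p i))) ?n)"
    by (simp add: q_def coeff_sum)
  also have "\<dots> = (\<Sum>p | p permutes (UNIV::'n set). if p = id then (-1) ^ ?n else 0)"
  proof (intro sum.cong refl)
    fix p :: "'n \<Rightarrow> 'n" assume "p \<in> {p. p permutes UNIV}"
    show "coeff (of_int (sign p) * (\<Prod>i\<in>UNIV. e i (p i))) ?n = (if p = id then (-1) ^ ?n else 0)"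
    proof (cases "p = id")
      case True then show ?thesis using coeff_id by (simp add: sign_id)
    next
      case False
      then obtain i where "p i \<noteq> i" by (auto simp: fun_eq_iff)
      then have "card {i. p i = i} < ?n" by (intro psubset_card_mono) auto
      then show ?thesis using False degp[of p] by (simp add: coeff_eq_0)
    qed
  qed
  also have "\<dots> = (-1) ^ ?n" by (simp add: permutes_id finite_permutations)
  finally have cq: "coeff q ?n = (-1) ^ ?n" .
  then have "?n \<le> degree q" by (intro le_degree) simp
  with \<open>degree q \<le> ?n\<close> have deg: "degree q = ?n" by simp
  have sz: "size (proots q) = ?n" using deg by (simp add: size_proots_complex)
  have "det (A - mat c) = (\<Prod>x\<in>#proots q. x - c)" for c
  proof -
    have "det (A - mat c) = poly (smult (lead_coeff q) (\<Prod>x\<in>#proots q. [:-x, 1:])) c"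
      by (simp add: complex_poly_decompose_multiset poly_q)
    also have "\<dots> = (-1) ^ size (proots q) * (\<Prod>x\<in>#proots q. c - x)"
      by (simp add: poly_prod_mset deg cq sz)
    also have "\<dots> = (\<Prod>x\<in>#proots q. x - c)"
    proof -
      have "(-1) ^ size N * (\<Prod>x\<in>#N. c - x) = (\<Prod>x\<in>#N. x - c)" for N :: "complex multiset"
        by (induction N) (auto simp: algebra_simps)
      then show ?thesis by this
    qed
    finally show ?thesis .
  qed
  with sz show ?thesis by (rule that)
qed

section \<open>Rank-one perturbations of the identity\<close>

definition rank_one :: "complex ^ 'n \<Rightarrow> complex ^ 'n ^ 'n" where
  "rank_one u = (\<chi> i j. u $ i * cnj (u $ j))"

text \<open>This is \<open>I + \<beta> u u*\<close>. For a unit vector \<open>u\<close>, the choice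
  \<open>\<beta> = b - 1\<close> gives a Blaschke-Potapov factor, \<open>1 / b - 1\<close> its
  inverse, and \<open>-2\<close> a Householder reflection.\<close>

definition rank_one_update :: "complex \<Rightarrow> complex ^ 'n \<Rightarrow> complex ^ 'n ^ 'n" where
  "rank_one_update \<beta> u = (\<chi> i j. mat 1 $ i $ j + \<beta> * rank_one u $ i $ j)"

lemma rank_one_update_mult_vec: "rank_one_update \<beta> u *v x = x + (\<beta> * cinner x u) *s u"
proof -
  have "(rank_one_update \<beta> u *v x) $ i = (x + (\<beta> * cinner x u) *s u) $ i" for i
  proof -
    have "(rank_one_update \<beta> u *v x) $ i =
        (\<Sum>j\<in>UNIV. (if i = j then x $ j else 0) + \<beta> * u $ i * (x $ j * cnj (u $ j)))"
      by (auto simp: rank_one_update_def rank_one_def matrix_vector_mult_def mat_def algebra_simps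
          intro!: sum.cong)
    also have "\<dots> = x $ i + \<beta> * u $ i * cinner x u"
      by (simp add: sum.distrib cinner_def flip: sum_distrib_left)
    finally show ?thesis by simp
  qed
  then show ?thesis by (simp add: vec_eq_iff)
qed

text \<open>The component of \<open>x\<close> along \<open>u\<close> is multiplied by
  \<open>1 + \<beta>\<close>, the orthogonal one is kept.\<close>

lemma norm_rank_one_update:
  assumes "norm u = 1"
  shows "(norm (rank_one_update \<beta> u *v x))\<^sup>2 =
    (norm x)\<^sup>2 + ((cmod (1 + \<beta>))\<^sup>2 - 1) * (cmod (cinner x u))\<^sup>2"
proof -
  have "Re (cnj (\<beta> * cinner x u) * cinner x u) = Re \<beta> * (cmod (cinner x u))\<^sup>2"
    by (simp add: cmod_power2) (simp add: power2_eq_square algebra_simps)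
  moreover have "(cmod (1 + \<beta>))\<^sup>2 = 1 + 2 * Re \<beta> + (cmod \<beta>)\<^sup>2"
    by (simp add: cmod_power2) (simp add: power2_eq_square algebra_simps)
  ultimately show ?thesis
    using assms
    by (simp add: rank_one_update_mult_vec norm_add_square norm_cscale cinner_scale_right norm_mult
        power_mult_distrib algebra_simps)
qed

lemma contractive_rank_one_update:
  assumes "norm u = 1" "cmod (1 + \<beta>) \<le> 1"
  shows "contractive (rank_one_update \<beta> u)"
  unfolding contractive_def
proof
  fix x
  have "((cmod (1 + \<beta>))\<^sup>2 - 1) * (cmod (cinner x u))\<^sup>2 \<le> 0"
    using assms(2) by (intro mult_nonpos_nonneg) (auto simp: power_le_one)
  then have "(norm (rank_one_update \<beta> u *v x))\<^sup>2 \<le> (norm x)\<^sup>2"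
    using norm_rank_one_update[OF assms(1)] by simp
  then show "norm (rank_one_update \<beta> u *v x) \<le> norm x"
    by (rule power2_le_imp_le) simp
qed

section \<open>Determinant bounds for contractions\<close>

lemma contractive_eigenvalue:
  assumes "contractive A" "det (A - mat e) = 0" shows "cmod e \<le> 1"
proof -
  obtain x where "norm x = 1" "(A - mat e) *v x = 0"
    using assms(2) det_0_kernel by blast
  then have "A *v x = e *s x"
    by (simp add: matrix_vector_mult_diff_rdistrib mat_mult_vec)
  then show ?thesis
    using contractiveD[OF assms(1), of x] \<open>norm x = 1\<close> by (simp add: norm_cscale)
qed

text \<open>The determinant is the product of the eigenvalues, and the remaining ones have modulus
  at most 1.\<close>

lemma det_contractive_le_eigenvalue:
  assumes A: "contractive A" and e: "det (A - mat e) = 0" shows "cmod (det A) \<le> cmod e"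
proof -
  obtain M where M: "\<And>c. det (A - mat c) = (\<Prod>x\<in>#M. x - c)"
    using det_shift_factorization by blast
  have "e \<in># M" using e by (auto simp: M prod_mset_zero_iff)
  then obtain M' where M': "M = add_mset e M'" by (metis multi_member_split)
  have le: "cmod x \<le> 1" if "x \<in># M" for x
    using that by (intro contractive_eigenvalue[OF A]) (auto simp: M prod_mset_zero_iff)
  have "det A = (\<Prod>x\<in>#M. x)" using M[of 0] by (simp add: mat_def zero_vec_def[symmetric])
  also have "\<dots> = e * (\<Prod>x\<in>#M'. x)" by (simp add: M')
  finally have "cmod (det A) = cmod e * cmod (\<Prod>x\<in>#M'. x)" by (simp add: norm_mult)
  moreover have "cmod (\<Prod>x\<in>#M'. x) \<le> 1"
    using le unfolding M' by (induction M') (auto simp: norm_mult intro!: mult_le_one)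
  ultimately show ?thesis by (simp add: mult_left_le)
qed

text \<open>Householder reflection in the difference of two unit vectors. Over the complex numbers
  it exchanges them only if their inner product is real, hence the phase \<alpha>, which makes it
  nonnegative. A reflection is an involution, so its determinant is a sign.\<close>

lemma reflection_exists:
  fixes x y :: "complex ^ 'n"
  assumes x: "norm x = 1" and y: "norm y = 1"
  obtains U \<alpha> where "contractive U" "cmod (det U) = 1" "cmod \<alpha> = 1" "U *v y = \<alpha> *s x"
proof -
  define \<alpha> where "\<alpha> = (if cinner y x = 0 then 1 else cinner y x / of_real (cmod (cinner y x)))"
  have \<alpha>: "cmod \<alpha> = 1" by (simp add: \<alpha>_def norm_divide)
  define w where "w = y - \<alpha> *s x"
  have yx: "cinner y (\<alpha> *s x) = of_real (cmod (cinner y x))"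
    by (auto simp: \<alpha>_def cinner_scale_right mult.commute complex_norm_square[symmetric] power2_eq_square)
  have nx: "norm (\<alpha> *s x) = 1" using x \<alpha> by (simp add: norm_cscale)
  show ?thesis
  proof (cases "w = 0")
    case True
    then show ?thesis
      using \<alpha> by (intro that[of "mat 1" \<alpha>]) (auto simp: w_def contractive_mat_1)
  next
    case False
    define u where "u = of_real (inverse (norm w)) *s w"
    have u: "norm u = 1" using False by (simp add: u_def norm_cscale norm_inverse del: of_real_inverse)
    have w2: "(norm w)\<^sup>2 = 2 * (1 - cmod (cinner y x))"
      using y nx by (simp add: w_def norm_diff_square yx)
    have yw: "cinner y w = of_real ((norm w)\<^sup>2 / 2)"
      unfolding w2 using y by (simp add: w_def cinner_diff_right yx cinner_self)
    define U where "U = rank_one_update (-2) u"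
    have "U *v (U *v v) = v" for v
      using u
      by (simp add: U_def rank_one_update_mult_vec cinner_add_left cinner_scale_left cinner_self
          vec_eq_iff algebra_simps)
    then have "U ** U = mat 1"
      by (simp add: matrix_eq flip: matrix_vector_mul_assoc)
    then have "det U * det U = 1" by (metis det_I det_mul)
    then have "cmod (det U) * cmod (det U) = 1" by (metis norm_mult norm_one)
    then have "cmod (det U) = 1"
      using norm_ge_zero[of "det U"] by (auto simp: square_eq_1_iff)
    moreover have "U *v y = \<alpha> *s x"
    proof -
      have "U *v y = y - (2 * cinner y u) *s u"
        by (simp add: U_def rank_one_update_mult_vec vec_eq_iff)
      also have "(2 * cinner y u) *s u = w"
        using False
        by (simp add: u_def cinner_scale_right yw vec_eq_iff field_simps power2_eq_square)
      finally show ?thesis by (simp add: w_def)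
    qed
    ultimately show ?thesis
      using \<alpha> u by (intro that[of U \<alpha>]) (auto simp: U_def intro!: contractive_rank_one_update)
  qed
qed

text \<open>Turning the direction of \<open>A x\<close> back to that of \<open>x\<close> makes
  \<open>x\<close> an eigenvector of \<open>U ** A\<close> with eigenvalue of modulus
  \<open>|A x|\<close>, so the eigenvalue bound applies. Minimized over \<open>x\<close>, the right
  side is the smallest singular value of \<open>A\<close>.\<close>

lemma det_contractive_le_norm:
  assumes A: "contractive A" and x: "norm x = 1" shows "cmod (det A) \<le> norm (A *v x)"
proof (cases "A *v x = 0")
  case True
  then show ?thesis using x det_0_kernel[of A] by auto
next
  case False
  define s where "s = norm (A *v x)"
  define y where "y = of_real (inverse s) *s (A *v x)"
  have s: "s > 0" using False by (simp add: s_def)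
  have "norm y = 1" using s by (simp add: y_def norm_cscale norm_inverse s_def del: of_real_inverse)
  then obtain U \<alpha> where U: "contractive U" "cmod (det U) = 1" "cmod \<alpha> = 1" "U *v y = \<alpha> *s x"
    using reflection_exists[OF x] by blast
  have "A *v x = of_real s *s y" using s by (simp add: y_def vec_eq_iff)
  then have "U *v (A *v x) = (of_real s * \<alpha>) *s x"
    using U(4) by (simp add: vec.scale vector_smult_assoc)
  then have "((U ** A) - mat (of_real s * \<alpha>)) *v x = 0"
    by (simp add: matrix_vector_mult_diff_rdistrib mat_mult_vec flip: matrix_vector_mul_assoc)
  then have "det (U ** A - mat (of_real s * \<alpha>)) = 0"
    using x det_0_kernel by blast
  then have "cmod (det (U ** A)) \<le> cmod (of_real s * \<alpha>)"
    by (intro det_contractive_le_eigenvalue contractive_mult U A)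
  then show ?thesis using U s by (simp add: det_mul norm_mult s_def)
qed

lemma det_contractive_le_1:
  fixes A :: "complex ^ 'n ^ 'n"
  assumes A: "contractive A" shows "cmod (det A) \<le> 1"
proof -
  have x: "norm (axis undefined 1 :: complex ^ 'n) = 1" by (simp add: norm_axis_unit)
  show ?thesis
    using det_contractive_le_norm[OF A x] contractiveD[OF A, of "axis undefined 1"] x by linarith
qed

text \<open>The determinant bound and contractivity squeeze \<open>norm (V *v x)\<close> to 1 on
  unit vectors. Polarization turns the isometry into \<open>V* V = I\<close>, and a one-sided
  inverse of a square matrix is two-sided.\<close>

lemma contractive_det_1_unitary:
  assumes V: "contractive V" and d: "cmod (det V) = 1" shows "unitary_matrix V"
proof -
  have iso1: "norm (V *v x) = 1" if "norm x = 1" for x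
    using det_contractive_le_norm[OF V that] contractiveD[OF V, of x] d that by linarith
  have iso: "norm (V *v x) = norm x" for x
  proof (cases "x = 0")
    case False
    define y where "y = of_real (inverse (norm x)) *s x"
    have "x = of_real (norm x) *s y" using False by (simp add: y_def vec_eq_iff)
    then have "norm (V *v x) = norm x * norm (V *v y)"
      by (metis norm_cscale norm_of_real abs_norm_cancel vec.scale)
    also have "norm (V *v y) = 1"
      using False by (intro iso1) (simp add: y_def norm_cscale norm_inverse del: of_real_inverse)
    finally show ?thesis by simp
  qed simp
  have ip: "(V *v x) \<bullet> (V *v y) = x \<bullet> y" for x y
  proof -
    have "(norm (V *v x + V *v y))\<^sup>2 = (norm (x + y))\<^sup>2"
      by (metis iso matrix_vector_right_distrib)
    then show ?thesis by (simp add: norm_add_square iso Re_cinner)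
  qed
  have "adjoint_matrix V *v (V *v y) = y" for y
  proof -
    have "x \<bullet> (adjoint_matrix V *v (V *v y) - y) = 0" for x
      using ip[of x y] cinner_adjoint[of V x "V *v y"]
      by (metis Re_cinner diff_self inner_diff_right)
    then show ?thesis by (metis inner_eq_zero_iff eq_iff_diff_eq_0)
  qed
  then have "adjoint_matrix V ** V = mat 1"
    by (simp add: matrix_eq flip: matrix_vector_mul_assoc)
  then show ?thesis
    unfolding unitary_matrix_def using matrix_left_right_inverse by blast
qed

lemma det_adjoint: "det (adjoint_matrix A) = cnj (det A)"
proof -
  have "det (adjoint_matrix A) = det (transpose (adjoint_matrix A))" by (simp add: det_transpose)
  also have "\<dots> = cnj (det A)"
    by (simp add: det_def adjoint_matrix_def transpose_def cnj_sum cnj_prod)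
  finally show ?thesis .
qed

lemma unitary_det:
  assumes "unitary_matrix U" shows "cmod (det U) = 1"
proof -
  have "cnj (det U) * det U = 1"
    using assms by (metis det_I det_adjoint det_mul unitary_matrix_def)
  then have "(cmod (det U))\<^sup>2 = 1"
    by (metis complex_norm_square mult.commute of_real_eq_1_iff)
  then show ?thesis by (simp add: power2_eq_1_iff) (smt (verit) norm_ge_zero)
qed

section \<open>Contractive holomorphic matrix functions\<close>

lemma cinner_zero_right: "cinner x 0 = 0"
  by (simp add: cinner_def)

section \<open>Estimates for scalar Blaschke factors\<close>

lemma norm_blaschke_factor: "cmod (blaschke_factor a z) = cmod (a - z) / cmod (1 - cnj a * z)"
  by (simp add: blaschke_factor_def norm_mult norm_divide)

lemma one_minus_cnj_mult_ge:
  assumes "cmod z \<le> 1" shows "1 - cmod a \<le> cmod (1 - cnj a * z)"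
proof -
  have "1 - cmod a \<le> 1 - cmod (cnj a * z)"
    using assms by (simp add: norm_mult mult_left_le)
  also have "\<dots> \<le> cmod (1 - cnj a * z)"
    using norm_triangle_ineq2[of 1 "cnj a * z"] by simp
  finally show ?thesis .
qed

lemma one_minus_norm_blaschke_factor:
  assumes "cmod a < 1" "cmod z \<le> 1"
  shows "1 - (cmod (blaschke_factor a z))\<^sup>2 =
    (1 - (cmod a)\<^sup>2) * (1 - (cmod z)\<^sup>2) / (cmod (1 - cnj a * z))\<^sup>2"
proof -
  have "cmod (1 - cnj a * z) > 0"
    using one_minus_cnj_mult_ge[OF assms(2), of a] assms(1) by linarith
  moreover have "(cmod (1 - cnj a * z))\<^sup>2 - (cmod (a - z))\<^sup>2 = (1 - (cmod a)\<^sup>2) * (1 - (cmod z)\<^sup>2)"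
    unfolding cmod_power2 by (simp add: power2_eq_square algebra_simps)
  ultimately show ?thesis
    by (simp add: norm_blaschke_factor power_divide divide_simps)
qed

lemma norm_blaschke_factor_le_1:
  assumes "cmod a < 1" "cmod z \<le> 1" shows "cmod (blaschke_factor a z) \<le> 1"
proof -
  have "0 \<le> (1 - (cmod a)\<^sup>2) * (1 - (cmod z)\<^sup>2) / (cmod (1 - cnj a * z))\<^sup>2"
    using assms by (intro divide_nonneg_nonneg mult_nonneg_nonneg) (auto simp: power_le_one)
  then have "(cmod (blaschke_factor a z))\<^sup>2 \<le> 1\<^sup>2"
    using one_minus_norm_blaschke_factor[OF assms] by simp
  then show ?thesis by (rule power2_le_imp_le) simp
qed

text \<open>The lower bound depends on \<open>z\<close> only through its modulus and tends to 1 at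
  the circle, as a maximum principle on growing discs requires.\<close>

lemma norm_blaschke_factor_near_circle:
  assumes "cmod a < 1" "cmod z \<le> 1"
  shows "1 - (1 - (cmod z)\<^sup>2) / (1 - cmod a)\<^sup>2 \<le> (cmod (blaschke_factor a z))\<^sup>2"
proof -
  have "1 - (cmod (blaschke_factor a z))\<^sup>2 \<le> 1 * (1 - (cmod z)\<^sup>2) / (1 - cmod a)\<^sup>2"
    unfolding one_minus_norm_blaschke_factor[OF assms]
    using assms one_minus_cnj_mult_ge[OF assms(2), of a]
    by (intro frac_le mult_right_mono power_mono) (auto simp: power_le_one)
  then show ?thesis by simp
qed

text \<open>The 8 is 4 times 2, from \<open>|1 - cnj a * z|^2 \<le> 4\<close> and
  \<open>1 - b^2 \<le> 2 * (1 - b)\<close>. For fixed \<open>z\<close>, a zero at \<open>a\<close>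
  thus costs at least a fixed multiple of \<open>1 - |a|\<close>, which leads to the Blaschke
  condition.\<close>

lemma one_minus_norm_blaschke_factor_ge:
  assumes "cmod a < 1" "cmod z < 1"
  shows "(1 - cmod a) * ((1 - (cmod z)\<^sup>2) / 8) \<le> 1 - cmod (blaschke_factor a z)"
proof -
  let ?b = "cmod (blaschke_factor a z)"
  have pos: "cmod (1 - cnj a * z) > 0"
    using one_minus_cnj_mult_ge[of z a] assms by linarith
  have b: "0 \<le> ?b" "?b \<le> 1" using norm_blaschke_factor_le_1 assms by auto
  have "cmod (1 - cnj a * z) \<le> 1 + cmod a * cmod z"
    using norm_triangle_ineq4[of 1 "cnj a * z"] by (simp add: norm_mult)
  also have "\<dots> \<le> 1 + 1 * 1" using assms by (intro add_left_mono mult_mono) auto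
  finally have "cmod (1 - cnj a * z) \<le> 2" by simp
  then have "(cmod (1 - cnj a * z))\<^sup>2 \<le> 2\<^sup>2" by (intro power_mono) auto
  moreover have "(cmod a)\<^sup>2 \<le> cmod a" using assms by (simp add: power2_eq_square mult_left_le)
  moreover have "0 \<le> 1 - (cmod z)\<^sup>2" using assms by (simp add: power_le_one)
  ultimately have "(1 - cmod a) * (1 - (cmod z)\<^sup>2) / 4 \<le> 1 - ?b\<^sup>2"
    unfolding one_minus_norm_blaschke_factor[OF assms(1) less_imp_le[OF assms(2)]] using assms pos
    by (intro frac_le mult_right_mono mult_nonneg_nonneg) auto
  moreover have "1 - ?b\<^sup>2 \<le> 2 * (1 - ?b)"
    using zero_le_power2[of "1 - ?b"] unfolding power2_diff by simp
  ultimately show ?thesis by simp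
qed

text \<open>The normalization \<open>|a| / a\<close> brings the factor close to 1 for
  \<open>|a|\<close> near 1: over the denominator \<open>a * (1 - cnj a * z)\<close> the numerator
  of \<open>b - 1\<close> is \<open>-(1 - |a|) * (a + |a| * z)\<close>. At \<open>a = 0\<close>,
  where the factor is \<open>z\<close>, the crude bound 2 suffices.\<close>

lemma one_minus_blaschke_factor_le:
  assumes "cmod a < 1" "cmod z < 1"
  shows "cmod (blaschke_factor a z - 1) \<le> (1 - cmod a) * (2 / (1 - cmod z))"
proof (cases "a = 0")
  case True
  have "1 - cmod z \<le> 1" by simp
  then have "2 \<le> 2 / (1 - cmod z)"
    using assms by (simp add: field_simps)
  moreover have "cmod (z - 1) \<le> 2"
    using norm_triangle_ineq4[of z 1] assms by simp
  ultimately show ?thesis using True by (simp add: blaschke_factor_def)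
next
  case False
  let ?d = "1 - cnj a * z"
  have d: "1 - cmod z \<le> cmod ?d"
    using one_minus_cnj_mult_ge[of "cnj a" "cnj z"] assms by (simp add: mult.commute[of z])
  then have d0: "?d \<noteq> 0" using assms by auto
  have aa: "a * cnj a = of_real (cmod a) * of_real (cmod a)"
    using complex_norm_square[of a] by (simp add: power2_eq_square)
  have "blaschke_factor a z - 1 = (of_real (cmod a) * (a - z) - a * ?d) / (a * ?d)"
  proof -
    have "c / x * (w / d) - 1 = (c * w - x * d) / (x * d)" if "x \<noteq> 0" "d \<noteq> 0" for c x w d :: complex
      using that by (simp add: field_simps)
    from this[OF False d0] show ?thesis using False by (simp only: blaschke_factor_def if_False)
  qed
  also have "of_real (cmod a) * (a - z) - a * ?d = - of_real (1 - cmod a) * (a + of_real (cmod a) * z)"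
  proof -
    have "of_real (cmod a) * (a - z) - a * ?d =
        of_real (cmod a) * a - of_real (cmod a) * z - a + (a * cnj a) * z"
      by (simp add: algebra_simps)
    then show ?thesis unfolding aa by (simp add: algebra_simps)
  qed
  finally have "cmod (blaschke_factor a z - 1) =
      (1 - cmod a) * (cmod (a + of_real (cmod a) * z) / (cmod a * cmod ?d))"
    using assms by (simp add: norm_mult norm_divide del: of_real_diff)
  also have "cmod (a + of_real (cmod a) * z) \<le> cmod a * 2"
  proof -
    have "cmod (a + of_real (cmod a) * z) \<le> cmod a + cmod a * cmod z"
      using norm_triangle_ineq[of a "of_real (cmod a) * z"] by (simp add: norm_mult)
    also have "\<dots> \<le> cmod a + cmod a * 1" using assms by (intro add_left_mono mult_left_mono) auto
    finally show ?thesis by simp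
  qed
  then have "cmod (a + of_real (cmod a) * z) / (cmod a * cmod ?d) \<le> cmod a * 2 / (cmod a * (1 - cmod z))"
    using d assms False by (intro frac_le mult_left_mono) auto
  also have "\<dots> = 2 / (1 - cmod z)" using False by simp
  finally show ?thesis using assms by (simp add: mult_left_mono)
qed

section \<open>The matrix Schur class and the splitting of one factor\<close>

lemma bp_factor_rank_one:
  "bp_factor a (rank_one v) z = rank_one_update (blaschke_factor a z - 1) v"
  by (simp add: bp_factor_def rank_one_update_def)

text \<open>Remainders left after splitting off factors only have to be contractive inside the disc;
  this class avoids following their boundary values.\<close>

definition schur_class :: "(complex \<Rightarrow> complex ^ 'n ^ 'n) set" where
  "schur_class = {G. matrix_holomorphic_on G unit_disc \<and> (\<forall>z\<in>unit_disc. contractive (G z))}"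

lemma schur_classD:
  assumes "G \<in> schur_class"
  shows "matrix_holomorphic_on G unit_disc" "cmod z < 1 \<Longrightarrow> contractive (G z)"
  using assms by (auto simp: schur_class_def)

lemma holomorphic_on_det:
  "matrix_holomorphic_on G S \<Longrightarrow> (\<lambda>z. det (G z)) holomorphic_on S"
  unfolding det_def matrix_holomorphic_on_def by (intro holomorphic_intros) auto

lemma holomorphic_on_mult_vec:
  "matrix_holomorphic_on G S \<Longrightarrow> (\<lambda>z. (G z *v x) $ i) holomorphic_on S"
  unfolding matrix_vector_mult_def matrix_holomorphic_on_def
  by (simp, intro holomorphic_intros) auto

lemma holomorphic_on_cinner:
  "matrix_holomorphic_on G S \<Longrightarrow> (\<lambda>z. cinner (G z *v x) y) holomorphic_on S"
  unfolding cinner_def by (intro holomorphic_intros holomorphic_on_mult_vec)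

lemma contractiveI_cinner:
  assumes "\<And>x y. cmod (cinner (A *v x) y) \<le> norm x * norm y" shows "contractive A"
  unfolding contractive_def
proof
  fix x
  have "(norm (A *v x))\<^sup>2 \<le> norm x * norm (A *v x)"
    using assms[of x "A *v x"] by (simp add: cinner_self norm_power)
  then show "norm (A *v x) \<le> norm x"
    by (cases "A *v x = 0") (auto simp: power2_eq_square)
qed

text \<open>One factor of Potapov's factorization is split off at a zero \<open>a\<close> of \<open>det G\<close>. The quotient
  is again contractive by the maximum principle, because the inverse of the factor has norm
  \<open>1 / |b\<^sub>a|\<close>, which tends to \<open>1\<close> at the circle.\<close>

lemma schur_class_split_factor:
  fixes G :: "complex \<Rightarrow> complex ^ 'n ^ 'n"
  assumes G: "G \<in> schur_class" and a: "cmod a < 1" and 0: "det (G a) = 0"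
  obtains H v where "H \<in> schur_class" "norm v = 1"
    "\<And>z. cmod z < 1 \<Longrightarrow> G z = H z ** bp_factor a (rank_one v) z"
proof -
  obtain v where v: "norm v = 1" "G a *v v = 0" using 0 det_0_kernel by blast
  \<comment> \<open>Quotient of \<open>G z *v v\<close> by \<open>z - a\<close>, with the removable
    singularity at \<open>a\<close> filled in.\<close>
  define h where "h i z = (if z = a then deriv (\<lambda>z. (G z *v v) $ i) a
      else ((G z *v v) $ i - (G a *v v) $ i) / (z - a))" for i z
  have hol_h: "h i holomorphic_on unit_disc" for i
    unfolding h_def using a
    by (intro pole_lemma holomorphic_on_mult_vec schur_classD G) auto
  have h: "(z - a) * h i z = (G z *v v) $ i" for i z
    using v by (simp add: h_def)
  \<comment> \<open>Chosen so that \<open>b z * (\<kappa> * (1 - cnj a * z)) = z - a\<close>; then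
    \<open>q\<close> is \<open>G v / b\<close>, also across the zero of \<open>b\<close>.\<close>
  define \<kappa> where "\<kappa> = (if a = 0 then 1 else - a / of_real (cmod a))"
  define q where "q z = (\<chi> i. \<kappa> * (1 - cnj a * z) * h i z)" for z
  define b where "b = blaschke_factor a"
  have b: "b z * (\<kappa> * (1 - cnj a * z)) = z - a" if "cmod z < 1" for z
  proof -
    have "1 - cnj a * z \<noteq> 0" using one_minus_cnj_mult_ge[of z a] a that by auto
    then show ?thesis by (auto simp: b_def blaschke_factor_def \<kappa>_def)
  qed
  have bq: "b z *s q z = G z *v v" if "cmod z < 1" for z
    using b[OF that] h by (simp add: vec_eq_iff q_def flip: mult.assoc)
  \<comment> \<open>\<open>H\<close> agrees with \<open>G\<close> on the orthogonal complement of
    \<open>v\<close> and sends \<open>v\<close> to \<open>q\<close>: it is \<open>G\<close> times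
    the inverse factor, written without division by \<open>b\<close>.\<close>
  define H where "H z = (\<chi> i j. G z $ i $ j + (q z $ i - (G z *v v) $ i) * cnj (v $ j))" for z
  have H: "H z *v x = G z *v x + cinner x v *s (q z - G z *v v)" for z x
  proof -
    have "(H z *v x) $ i = (G z *v x + cinner x v *s (q z - G z *v v)) $ i" for i
    proof -
      have "(H z *v x) $ i = (\<Sum>j\<in>UNIV. G z $ i $ j * x $ j +
          (q z $ i - (G z *v v) $ i) * (x $ j * cnj (v $ j)))"
        by (auto simp: H_def matrix_vector_mult_def algebra_simps intro!: sum.cong)
      also have "\<dots> = (G z *v x) $ i + (q z $ i - (G z *v v) $ i) * cinner x v"
        by (simp add: sum.distrib cinner_def matrix_vector_mult_def flip: sum_distrib_left)
      finally show ?thesis by (simp add: algebra_simps)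
    qed
    then show ?thesis unfolding vec_eq_iff by blast
  qed
  have hol_H: "matrix_holomorphic_on H unit_disc"
    using schur_classD(1)[OF G] hol_h holomorphic_on_mult_vec[OF schur_classD(1)[OF G]]
    unfolding matrix_holomorphic_on_def H_def q_def
    by (simp, intro allI holomorphic_intros) auto
  have HB: "G z = H z ** bp_factor a (rank_one v) z" if "cmod z < 1" for z
  proof -
    have "(H z ** bp_factor a (rank_one v) z) *v x = G z *v x" for x
    proof -
      have "(H z ** bp_factor a (rank_one v) z) *v x =
          H z *v x + ((b z - 1) * cinner x v) *s (H z *v v)"
        by (simp add: bp_factor_rank_one rank_one_update_mult_vec b_def matrix_vector_right_distrib
            vec.scale flip: matrix_vector_mul_assoc)
      also have "H z *v v = q z" using v by (simp add: H cinner_self)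
      also have "H z *v x + ((b z - 1) * cinner x v) *s q z = G z *v x"
        unfolding H bq[OF that, symmetric] by (simp add: vec_eq_iff algebra_simps)
      finally show ?thesis .
    qed
    then show ?thesis by (simp add: matrix_eq)
  qed
  have bound_b: "cmod (b z) * norm (H z *v x) \<le> norm x" if z: "cmod z < 1" for z x
  proof (cases "b z = 0")
    case False
    have u: "H z *v x = G z *v (rank_one_update (1 / b z - 1) v *v x)"
      unfolding H bq[OF z, symmetric] rank_one_update_mult_vec matrix_vector_right_distrib vec.scale
      unfolding bq[OF z, symmetric]
      using False by (simp add: vec_eq_iff algebra_simps)
    have c: "(cmod (b z))\<^sup>2 \<le> 1"
      unfolding b_def using norm_blaschke_factor_le_1[OF a] z by (simp add: power_le_one)
    have "(cmod (b z) * norm (rank_one_update (1 / b z - 1) v *v x))\<^sup>2 =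
        (cmod (b z))\<^sup>2 * (norm x)\<^sup>2 + (1 - (cmod (b z))\<^sup>2) * (cmod (cinner x v))\<^sup>2"
      using False
      by (simp add: power_mult_distrib norm_rank_one_update[OF v(1)] norm_divide power_divide field_simps)
    also have "\<dots> \<le> (cmod (b z))\<^sup>2 * (norm x)\<^sup>2 + (1 - (cmod (b z))\<^sup>2) * (norm x)\<^sup>2"
      using c cmod_cinner_le[of x v] v by (intro add_left_mono mult_left_mono power_mono) auto
    also have "\<dots> = (norm x)\<^sup>2" by (simp add: algebra_simps)
    finally have "cmod (b z) * norm (rank_one_update (1 / b z - 1) v *v x) \<le> norm x"
      by (rule power2_le_imp_le) simp
    moreover have "norm (H z *v x) \<le> norm (rank_one_update (1 / b z - 1) v *v x)"
      unfolding u by (rule contractiveD[OF schur_classD(2)[OF G z]])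
    ultimately show ?thesis by (meson mult_left_mono norm_ge_zero order_trans)
  qed simp
  have "contractive (H z0)" if z0: "cmod z0 < 1" for z0
  proof (rule contractiveI_cinner)
    fix x y
    let ?f = "\<lambda>z. cinner (H z *v x) y"
    have holf: "?f holomorphic_on unit_disc" by (rule holomorphic_on_cinner[OF hol_H])
    \<comment> \<open>A lower bound for \<open>|b|^2\<close> on the circle of radius \<rho>.
      Multiplying by \<open>m \<rho>\<close> instead of dividing keeps the estimate true where
      \<open>m \<rho>\<close> is not positive and lets \<rho> tend to 1.\<close>
    define m where "m \<rho> = 1 - (1 - \<rho>\<^sup>2) / (1 - cmod a)\<^sup>2" for \<rho> :: real
    have step: "(cmod (?f z0))\<^sup>2 * m \<rho> \<le> (norm x * norm y)\<^sup>2" if \<rho>: "cmod z0 < \<rho>" "\<rho> < 1" for \<rho>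
    proof (cases "m \<rho> > 0")
      case True
      have "cmod (?f z0) \<le> norm x * norm y / sqrt (m \<rho>)"
      proof (rule maximum_modulus_frontier[where S = "ball 0 \<rho>" and f = ?f and \<xi> = z0])
        show "?f holomorphic_on interior (ball 0 \<rho>)"
          using \<rho> by (intro holomorphic_on_subset[OF holf]) auto
        show "continuous_on (closure (ball 0 \<rho>)) ?f"
        proof (rule continuous_on_subset[OF holomorphic_on_imp_continuous_on[OF holf]])
          have "0 < \<rho>" using \<rho>(1) norm_ge_zero[of z0] by linarith
          then show "closure (ball 0 \<rho>) \<subseteq> unit_disc" using \<rho> by (auto simp: closure_ball)
        qed
        show "bounded (ball (0::complex) \<rho>)" by simp
        show "z0 \<in> ball 0 \<rho>" using \<rho> by simp
        fix z :: complex assume "z \<in> frontier (ball 0 \<rho>)"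
        moreover have "0 < \<rho>" using \<rho>(1) norm_ge_zero[of z0] by linarith
        ultimately have z: "cmod z = \<rho>" by (simp add: frontier_ball)
        then have "m \<rho> \<le> (cmod (b z))\<^sup>2"
          unfolding m_def b_def using norm_blaschke_factor_near_circle[OF a, of z] \<rho> by simp
        then have s: "sqrt (m \<rho>) \<le> cmod (b z)" by (rule real_le_lsqrt[rotated -1]) simp_all
        have "cmod (?f z) * sqrt (m \<rho>) \<le> (norm (H z *v x) * norm y) * cmod (b z)"
          using True by (intro mult_mono cmod_cinner_le s) auto
        also have "\<dots> = (cmod (b z) * norm (H z *v x)) * norm y" by simp
        also have "\<dots> \<le> norm x * norm y"
          using bound_b[of z x] z \<rho> by (intro mult_right_mono) auto
        finally show "cmod (?f z) \<le> norm x * norm y / sqrt (m \<rho>)"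
          using True by (simp add: field_simps)
      qed
      then have "(cmod (?f z0))\<^sup>2 \<le> (norm x * norm y / sqrt (m \<rho>))\<^sup>2" by (intro power_mono) auto
      then show ?thesis using True by (simp add: power_divide field_simps)
    next
      case False
      then have "(cmod (?f z0))\<^sup>2 * m \<rho> \<le> 0" by (simp add: mult_nonneg_nonpos)
      then show ?thesis by (smt (verit) zero_le_power2)
    qed
    have "((\<lambda>\<rho>. (cmod (?f z0))\<^sup>2 * m \<rho>) \<longlongrightarrow> (cmod (?f z0))\<^sup>2 * m 1) (at_left 1)"
      unfolding m_def by (intro tendsto_intros) (use a in auto)
    moreover have "eventually (\<lambda>\<rho>. (cmod (?f z0))\<^sup>2 * m \<rho> \<le> (norm x * norm y)\<^sup>2) (at_left 1)"
      using eventually_at_left_real[OF z0] by eventually_elim (auto intro: step)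
    ultimately have "(cmod (?f z0))\<^sup>2 * m 1 \<le> (norm x * norm y)\<^sup>2"
      by (rule tendsto_upperbound) simp
    then have "(cmod (?f z0))\<^sup>2 \<le> (norm x * norm y)\<^sup>2" by (simp add: m_def)
    then show "cmod (?f z0) \<le> norm x * norm y" by (rule power2_le_imp_le) simp
  qed
  then have "H \<in> schur_class" using hol_H by (simp add: schur_class_def)
  then show ?thesis using v(1) HB by (rule that)
qed

section \<open>Schwarz-Pick estimate and rigidity\<close>

lemma schwarz_pick_origin:
  assumes f: "f holomorphic_on unit_disc" and le: "\<And>z. cmod z < 1 \<Longrightarrow> cmod (f z) \<le> 1"
    and f0: "f 0 = of_real s" and s: "0 \<le> s" and z: "cmod z < 1"
  shows "cmod (f z - of_real s) * (1 - cmod z) \<le> 1 - s\<^sup>2"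
proof -
  have strict: "cmod (g z - of_real s) * (1 - cmod z) \<le> 1 - s\<^sup>2"
    if g: "g holomorphic_on unit_disc" "\<And>z. cmod z < 1 \<Longrightarrow> cmod (g z) < 1" "g 0 = of_real s" "0 \<le> s"
    for g s
  proof -
    have s1: "s < 1" using g(2)[of 0] g(3,4) by simp
    \<comment> \<open>Composition with the disc automorphism that sends \<open>s\<close> to 0. The
      Schwarz lemma gives \<open>|g - s| \<le> |z| |1 - s g|\<close>; expressing
      \<open>1 - s g\<close> through \<open>g - s\<close> makes this a linear inequality for
      \<open>|g - s|\<close>.\<close>
    define h where "h z = (g z - of_real s) / (1 - of_real s * g z)" for z
    have nz: "1 - of_real s * g z \<noteq> 0" if "cmod z < 1" for z
    proof
      assume "1 - of_real s * g z = 0"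
      then have "of_real s * g z = 1" by simp
      then have "cmod (of_real s * g z) = 1" by simp
      then have "s * cmod (g z) = 1" using g(4) by (simp add: norm_mult)
      moreover have "s * cmod (g z) \<le> s * 1"
        using g(2)[OF that] g(4) by (intro mult_left_mono) auto
      ultimately show False using s1 by simp
    qed
    have "h holomorphic_on unit_disc" unfolding h_def
      using nz by (intro holomorphic_intros g) auto
    moreover have "h 0 = 0" by (simp add: h_def g)
    moreover have "cmod (h z) < 1" if "cmod z < 1" for z
    proof -
      have "(cmod (1 - of_real s * g z))\<^sup>2 - (cmod (g z - of_real s))\<^sup>2 = (1 - s\<^sup>2) * (1 - (cmod (g z))\<^sup>2)"
        unfolding cmod_power2 by (simp add: power2_eq_square algebra_simps)
      moreover have "(1 - s\<^sup>2) * (1 - (cmod (g z))\<^sup>2) > 0"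
        using s1 g(2)[OF that] g(4) by (intro mult_pos_pos) (auto simp: power_less_one_iff abs_square_less_1)
      ultimately have "(cmod (g z - of_real s))\<^sup>2 < (cmod (1 - of_real s * g z))\<^sup>2" by simp
      then have "cmod (g z - of_real s) < cmod (1 - of_real s * g z)"
        by (rule power2_less_imp_less) simp
      then show ?thesis using nz[OF that] by (simp add: h_def norm_divide)
    qed
    ultimately have "cmod (h z) \<le> cmod z" using z by (rule Schwarz_Lemma(1))
    then have 1: "cmod (g z - of_real s) \<le> cmod z * cmod (1 - of_real s * g z)"
      using nz[OF z] by (simp add: h_def norm_divide field_simps)
    have "1 - of_real s * g z = of_real (1 - s\<^sup>2) - of_real s * (g z - of_real s)"
      by (simp add: algebra_simps power2_eq_square)
    then have "cmod (1 - of_real s * g z) \<le> cmod (of_real (1 - s\<^sup>2)) + cmod (of_real s * (g z - of_real s))"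
      by (subst \<open>1 - of_real s * g z = _\<close>) (rule norm_triangle_ineq4)
    also have "\<dots> = (1 - s\<^sup>2) + s * cmod (g z - of_real s)"
      using s1 g(4) by (simp add: norm_mult power_le_one del: of_real_diff)
    also have "\<dots> \<le> (1 - s\<^sup>2) + 1 * cmod (g z - of_real s)"
      using s1 by (intro add_left_mono mult_right_mono) auto
    finally have 2: "cmod (1 - of_real s * g z) \<le> (1 - s\<^sup>2) + cmod (g z - of_real s)" by simp
    have "cmod z * (1 - s\<^sup>2) \<le> 1 * (1 - s\<^sup>2)"
      using z s1 g(4) by (intro mult_right_mono) (auto simp: power_le_one)
    with 1 mult_left_mono[OF 2 norm_ge_zero[of z]] show ?thesis
      by (simp add: algebra_simps)
  qed
  \<comment> \<open>The Schwarz lemma needs values in the open disc, so it is applied to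
    \<open>t f\<close> with \<open>t < 1\<close>, and the inequality passes to the limit.\<close>
  let ?L = "\<lambda>t::real. cmod (of_real t * f z - of_real (t * s)) * (1 - cmod z)"
  have "eventually (\<lambda>t. ?L t \<le> 1 - (t * s)\<^sup>2) (at_left 1)"
    using eventually_at_left_real[of 0 1, OF zero_less_one]
  proof eventually_elim
    case (elim t)
    then have t: "0 < t" "t < 1" by auto
    show ?case
    proof (rule strict)
      show "(\<lambda>z. of_real t * f z) holomorphic_on unit_disc" by (intro holomorphic_intros f)
      show "cmod (of_real t * f z) < 1" if "cmod z < 1" for z
      proof -
        have "t * cmod (f z) \<le> t * 1" using t le[OF that] by (intro mult_left_mono) auto
        then have "t * cmod (f z) < 1" using t by linarith
        then show ?thesis using t by (simp add: norm_mult)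
      qed
    qed (use t f0 s in auto)
  qed
  moreover have "(?L \<longlongrightarrow> cmod (of_real 1 * f z - of_real (1 * s)) * (1 - cmod z)) (at_left 1)"
    "((\<lambda>t. 1 - (t * s)\<^sup>2) \<longlongrightarrow> 1 - (1 * s)\<^sup>2) (at_left 1)"
    by (intro tendsto_intros)+
  ultimately have "cmod (of_real 1 * f z - of_real (1 * s)) * (1 - cmod z) \<le> 1 - (1 * s)\<^sup>2"
    by (intro tendsto_le) auto
  then show ?thesis by simp
qed

text \<open>Pairing \<open>G z *v x\<close> with the direction \<open>y\<close> of
  \<open>G 0 *v x\<close> gives a scalar function whose value at 0 is \<open>s = |G(0) x|\<close>,
  and \<open>s \<ge> |det G(0)|\<close>. For \<open>s\<close> near 1 the Schwarz-Pick estimate keeps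
  it near \<open>s\<close>, and \<open>|G(z) x| \<le> 1\<close> leaves no room for a component
  transverse to \<open>y\<close>.\<close>

lemma schur_class_rigidity:
  assumes G: "G \<in> schur_class" and x: "norm x = 1" and z: "cmod z < 1"
  shows "(norm (G z *v x - G 0 *v x))\<^sup>2 \<le> (1 - (cmod (det (G 0)))\<^sup>2) * (1 + 2 / (1 - cmod z))"
proof -
  define s where "s = norm (G 0 *v x)"
  have s01: "0 \<le> s" "s \<le> 1"
    using contractiveD[OF schur_classD(2)[OF G, of 0], of x] x by (auto simp: s_def)
  \<comment> \<open>For \<open>s = 0\<close> the convention \<open>inverse 0 = 0\<close> gives
    \<open>y = 0\<close>; hence only \<open>norm y \<le> 1\<close> is claimed.\<close>
  define y where "y = of_real (inverse s) *s (G 0 *v x)"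
  have ny: "norm y \<le> 1"
    by (cases "s = 0") (auto simp: y_def norm_cscale norm_inverse s_def simp del: of_real_inverse)
  have G0: "G 0 *v x = of_real s *s y"
  proof (cases "s = 0")
    case True
    then have "G 0 *v x = 0" by (simp add: s_def)
    then show ?thesis using True by (simp add: vec_eq_iff)
  next
    case False
    then show ?thesis by (simp add: y_def vector_smult_assoc)
  qed
  have G0y: "cinner (G 0 *v x) y = of_real s"
    by (cases "s = 0")
      (simp_all add: y_def cinner_scale_right cinner_self s_def[symmetric] power2_eq_square cinner_zero_right)
  let ?f = "\<lambda>z. cinner (G z *v x) y"
  have Gx: "norm (G z *v x) \<le> 1" if "cmod z < 1" for z
    using contractiveD[OF schur_classD(2)[OF G that], of x] x by simp
  have "cmod (?f z - of_real s) * (1 - cmod z) \<le> 1 - s\<^sup>2"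
  proof (rule schwarz_pick_origin)
    show "?f holomorphic_on unit_disc" by (intro holomorphic_on_cinner schur_classD G)
    show "cmod (?f z) \<le> 1" if "cmod z < 1" for z
      using cmod_cinner_le[of "G z *v x" y] Gx[OF that] ny mult_le_one[of "norm (G z *v x)" "norm y"]
      by simp
  qed (use G0y s01 z in auto)
  then have f: "cmod (?f z - of_real s) \<le> (1 - s\<^sup>2) / (1 - cmod z)"
    using z by (simp add: field_simps)
  have "Re (?f z) \<ge> s - cmod (?f z - of_real s)"
    using abs_Re_le_cmod[of "?f z - of_real s"] by simp
  then have "s * Re (?f z) \<ge> s * (s - cmod (?f z - of_real s))"
    using s01 by (intro mult_left_mono) auto
  moreover have "s * cmod (?f z - of_real s) \<le> 1 * ((1 - s\<^sup>2) / (1 - cmod z))"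
    using s01 f by (intro mult_mono) auto
  ultimately have "s * Re (?f z) \<ge> s\<^sup>2 - (1 - s\<^sup>2) / (1 - cmod z)"
    by (simp add: power2_eq_square algebra_simps)
  moreover have "(norm (G z *v x - G 0 *v x))\<^sup>2 = (norm (G z *v x))\<^sup>2 - 2 * (s * Re (?f z)) + s\<^sup>2"
  proof -
    have "cinner (G z *v x) (G 0 *v x) = of_real s * ?f z"
      unfolding G0 by (simp add: cinner_scale_right)
    then show ?thesis unfolding norm_diff_square by (simp add: s_def)
  qed
  moreover have "(norm (G z *v x))\<^sup>2 \<le> 1" using Gx[OF z] by (simp add: power_le_one)
  moreover have "(1 - s\<^sup>2) * (1 + 2 / (1 - cmod z)) = (1 - s\<^sup>2) + 2 * ((1 - s\<^sup>2) / (1 - cmod z))"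
    by (simp add: distrib_left)
  \<comment> \<open>Pure linear arithmetic, used with \<open>p = s^2\<close>,
    \<open>q = (1 - s^2) / (1 - |z|)\<close>, \<open>t = s Re f\<close> and
    \<open>g = |G(z) x|^2\<close>.\<close>
  moreover have "N \<le> R" if "p - q \<le> t" "N = g - 2 * t + p" "g \<le> 1" "R = 1 - p + 2 * q"
    for N R p q t g :: real
    using that by linarith
  ultimately have "(norm (G z *v x - G 0 *v x))\<^sup>2 \<le> (1 - s\<^sup>2) * (1 + 2 / (1 - cmod z))"
    by blast
  also have "\<dots> \<le> (1 - (cmod (det (G 0)))\<^sup>2) * (1 + 2 / (1 - cmod z))"
  proof (rule mult_right_mono)
    have "cmod (det (G 0)) \<le> s"
      unfolding s_def by (intro det_contractive_le_norm schur_classD(2)[OF G] x) simp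
    then show "1 - s\<^sup>2 \<le> 1 - (cmod (det (G 0)))\<^sup>2" by (simp add: power_mono)
    show "0 \<le> 1 + 2 / (1 - cmod z)" using z by simp
  qed
  finally show ?thesis .
qed

section \<open>Circle means\<close>

lemma space_circle_measure [simp]: "space circle_measure = unit_circle"
  by (simp add: circle_measure_def space_restrict_space)

lemma sets_circle_measure [measurable_cong]:
  "sets circle_measure = sets (restrict_space borel unit_circle)"
  by (simp add: circle_measure_def)

lemma measurable_cis_circle: "cis \<in> measurable (uniform_measure lborel {0..<2 * pi}) (restrict_space borel unit_circle)"
proof (rule measurable_restrict_space2)
  have "cis \<in> borel_measurable borel"
    by (intro borel_measurable_continuous_onI continuous_intros)
  then show "cis \<in> borel_measurable (uniform_measure lborel {0..<2 * pi})"
    by (subst measurable_cong_sets[of _ borel _ borel]) simp_all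
qed auto

lemma emeasure_circle_measure: "emeasure circle_measure unit_circle = 1"
proof -
  let ?U = "uniform_measure lborel {0..<2 * pi}"
  have "unit_circle \<in> sets (restrict_space borel unit_circle)"
    using sets.top[of "restrict_space borel unit_circle"] by (simp add: space_restrict_space)
  then have "emeasure circle_measure unit_circle = emeasure ?U (cis -` unit_circle \<inter> space ?U)"
    unfolding circle_measure_def by (rule emeasure_distr[OF measurable_cis_circle])
  also have "cis -` unit_circle \<inter> space ?U = space ?U" by auto
  also have "emeasure ?U (space ?U) = 1"
    by (simp add: divide_ennreal)
  finally show ?thesis .
qed

lemma finite_measure_circle_measure: "finite_measure circle_measure"
  by (rule finite_measureI) (simp add: emeasure_circle_measure)

lemma borel_measurable_circle_measure:
  fixes f :: "complex \<Rightarrow> 'b :: real_normed_vector"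
  assumes "continuous_on unit_circle f" shows "f \<in> borel_measurable circle_measure"
  unfolding measurable_cong_sets[OF sets_circle_measure refl]
  by (rule borel_measurable_continuous_on_restrict[OF assms])

lemma integrable_circle_measure:
  fixes f :: "complex \<Rightarrow> 'b :: {banach, second_countable_topology}"
  assumes "continuous_on unit_circle f" shows "integrable circle_measure f"
proof -
  interpret finite_measure circle_measure by (rule finite_measure_circle_measure)
  have "bounded (f ` unit_circle)"
    by (intro compact_imp_bounded compact_continuous_image assms) simp
  then obtain B where "\<And>t. t \<in> unit_circle \<Longrightarrow> norm (f t) \<le> B"
    unfolding bounded_iff by blast
  then show ?thesis
    by (intro integrable_const_bound[where B = B] borel_measurable_circle_measure assms AE_I2) simp
qed

lemma integral_circle_measure:
  fixes f :: "complex \<Rightarrow> complex"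
  assumes f: "continuous_on unit_circle f"
  shows "(LINT t|circle_measure. f t) = integral {0..2 * pi} (\<lambda>\<theta>. f (cis \<theta>)) / (2 * pi)"
proof -
  have cont: "continuous_on UNIV (\<lambda>\<theta>. f (cis \<theta>))"
    by (rule continuous_on_compose2[OF f]) (auto intro!: continuous_intros)
  have "(LINT t|circle_measure. f t) = (LINT \<theta>|uniform_measure lborel {0..<2 * pi}. f (cis \<theta>))"
    unfolding circle_measure_def
    by (intro integral_distr measurable_cis_circle borel_measurable_continuous_on_restrict f)
  also have "uniform_measure lborel {0..<2 * pi} =
      density lborel (\<lambda>\<theta>. ennreal (indicator {0..<2 * pi} \<theta> / (2 * pi)))"
    unfolding uniform_measure_def
    by (intro density_cong) (auto split: split_indicator simp: divide_ennreal[symmetric] ennreal_1[symmetric] simp del: ennreal_1)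
  also have "(LINT \<theta>|\<dots>. f (cis \<theta>)) = (LINT \<theta>|lborel. (indicator {0..<2 * pi} \<theta> / (2 * pi)) *\<^sub>R f (cis \<theta>))"
    using borel_measurable_continuous_onI[OF cont]
    by (intro integral_density) auto
  also have "\<dots> = (LINT \<theta>|lborel. indicator {0..2 * pi} \<theta> *\<^sub>R f (cis \<theta>) / (2 * pi))"
  proof (rule integral_cong_AE)
    have "AE \<theta> in lborel. \<theta> \<noteq> 2 * pi" by (rule AE_lborel_singleton)
    then show "AE \<theta> in lborel. (indicator {0..<2 * pi} \<theta> / (2 * pi)) *\<^sub>R f (cis \<theta>) =
        indicator {0..2 * pi} \<theta> *\<^sub>R f (cis \<theta>) / (2 * pi)"
      by eventually_elim (auto simp: scaleR_conv_of_real field_simps split: split_indicator)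
  qed (use borel_measurable_continuous_onI[OF cont] in measurable)
  also have "\<dots> = (LINT \<theta>:{0..2 * pi}|lborel. f (cis \<theta>)) / (2 * pi)"
    by (simp add: set_lebesgue_integral_def)
  also have "(LINT \<theta>:{0..2 * pi}|lborel. f (cis \<theta>)) = integral {0..2 * pi} (\<lambda>\<theta>. f (cis \<theta>))"
    by (intro set_borel_integral_eq_integral borel_integrable_atLeastAtMost'
        continuous_on_subset[OF cont]) auto
  finally show ?thesis by simp
qed

section \<open>Mean value properties\<close>

lemma continuous_on_circle_dilation:
  assumes "continuous_on (ball 0 R) f" "0 \<le> r" "r < R"
  shows "continuous_on unit_circle (\<lambda>t. f (of_real r * t))"
  by (rule continuous_on_compose2[OF assms(1)])
    (use assms in \<open>auto intro!: continuous_intros simp: norm_mult\<close>)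

lemma circle_mean_value:
  assumes f: "f holomorphic_on ball 0 R" and r: "0 \<le> r" "r < R"
  shows "(LINT t|circle_measure. f (of_real r * t)) = f 0"
proof (cases "r = 0")
  case True
  interpret finite_measure circle_measure by (rule finite_measure_circle_measure)
  show ?thesis using True by (simp add: measure_def emeasure_circle_measure)
next
  case False
  then have r0: "0 < r" using r by simp
  have "((\<lambda>u. f u / (u - 0)) has_contour_integral (2 * of_real pi * \<i> * f 0)) (circlepath 0 r)"
    by (rule Cauchy_integral_circlepath_simple)
      (use r0 r in \<open>auto intro!: holomorphic_on_subset[OF f]\<close>)
  then have "((\<lambda>\<theta>. f (of_real r * cis \<theta>) / (of_real r * cis \<theta>) * r * \<i> * cis \<theta>)
      has_integral (2 * of_real pi * \<i> * f 0)) {0..2 * pi}"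
    unfolding circlepath_def by (subst (asm) has_contour_integral_part_circlepath_iff) auto
  then have "((\<lambda>\<theta>. \<i> * f (of_real r * cis \<theta>)) has_integral (\<i> * (2 * of_real pi * f 0))) {0..2 * pi}"
    using r0 by (simp add: mult_ac)
  then have "((\<lambda>\<theta>. f (of_real r * cis \<theta>)) has_integral (2 * of_real pi * f 0)) {0..2 * pi}"
    by (subst (asm) has_integral_mult_right_iff) auto
  then show ?thesis
    by (subst integral_circle_measure)
      (use r in \<open>auto intro!: continuous_on_circle_dilation holomorphic_on_imp_continuous_on[OF f]
        simp: integral_unique\<close>)
qed

text \<open>On a zero-free disc \<open>ln |f|\<close> is the real part of a holomorphic logarithm;
  this is Jensen's formula without zeros.\<close>

lemma circle_log_mean_value:
  assumes f: "f holomorphic_on ball 0 R" and nz: "\<And>z. cmod z < R \<Longrightarrow> f z \<noteq> 0" and r: "0 \<le> r" "r < R"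
  shows "(LINT t|circle_measure. ln (cmod (f (of_real r * t)))) = ln (cmod (f 0))"
    and "integrable circle_measure (\<lambda>t. ln (cmod (f (of_real r * t))))"
proof -
  have "0 < R" using r by linarith
  then obtain g where g: "g holomorphic_on ball 0 R" "\<And>z. z \<in> ball 0 R \<Longrightarrow> exp (g z) = f z"
    using holomorphic_logarithm_exists[of "ball 0 R" f 0] f nz by auto
  have ln: "ln (cmod (f z)) = Re (g z)" if "cmod z < R" for z
    using g(2)[of z] that by (metis ln_exp mem_ball_0 norm_exp_eq_Re)
  have cont: "continuous_on unit_circle (\<lambda>t. g (of_real r * t))"
    by (intro continuous_on_circle_dilation[OF holomorphic_on_imp_continuous_on[OF g(1)]] r)
  have int: "integrable circle_measure (\<lambda>t. g (of_real r * t))"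
    by (rule integrable_circle_measure[OF cont])
  have eq: "ln (cmod (f (of_real r * t))) = Re (g (of_real r * t))" if "t \<in> unit_circle" for t
    using that r by (intro ln) (simp add: norm_mult)
  have "(LINT t|circle_measure. ln (cmod (f (of_real r * t)))) = (LINT t|circle_measure. Re (g (of_real r * t)))"
    by (intro Bochner_Integration.integral_cong refl eq) simp
  also have "\<dots> = ln (cmod (f 0))"
    using circle_mean_value[OF g(1) r] int ln[of 0] \<open>0 < R\<close> by (simp add: integral_Re)
  finally show "(LINT t|circle_measure. ln (cmod (f (of_real r * t)))) = ln (cmod (f 0))" .
  have "integrable circle_measure (\<lambda>t. Re (g (of_real r * t)))"
    by (rule integrable_Re[OF int])
  then show "integrable circle_measure (\<lambda>t. ln (cmod (f (of_real r * t))))"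
    by (subst Bochner_Integration.integrable_cong[OF refl eq]) simp_all
qed

section \<open>Potapov factorization\<close>

text \<open>The positive part of \<open>ln (\<delta> / x)\<close>. Its value \<open>\<infinity>\<close> at \<open>0\<close> (where HOL has \<open>ln 0 = 0\<close>) makes it
  antimonotone in \<open>x\<close>, so zeros on the circles of integration need no separate treatment.\<close>

definition log_deficit :: "real \<Rightarrow> real \<Rightarrow> ennreal" where
  "log_deficit \<delta> x = (if x = 0 then \<infinity> else ennreal (ln \<delta> - ln x))"

lemma log_deficit_antimono:
  assumes "0 \<le> x" "x \<le> y" shows "log_deficit \<delta> y \<le> log_deficit \<delta> x"
  using assms by (auto simp: log_deficit_def intro!: ennreal_leI)

text \<open>In the application \<open>d\<close> is \<open>|det T|\<close> for the function
  \<open>T\<close> being factorized, a lower bound shared by all remainders \<open>H\<close>. One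
  integral over one circle thus controls every remainder whose zero-free disc contains that
  circle.\<close>

lemma det_schur_at_origin_ge:
  assumes H: "H \<in> schur_class" and r: "0 \<le> r" "r < \<rho>" "\<rho> \<le> 1"
    and nz: "\<And>z. cmod z < \<rho> \<Longrightarrow> det (H z) \<noteq> 0"
    and le: "\<And>z. cmod z < 1 \<Longrightarrow> d z \<le> cmod (det (H z))" and d0: "\<And>z. 0 \<le> d z"
    and int: "(\<integral>\<^sup>+t. log_deficit 1 (d (of_real r * t)) \<partial>circle_measure) \<le> ennreal \<epsilon>" and \<epsilon>: "0 \<le> \<epsilon>"
  shows "exp (- \<epsilon>) \<le> cmod (det (H 0))"
proof -
  let ?f = "\<lambda>z. det (H z)"
  have hol: "?f holomorphic_on ball 0 \<rho>"
    by (rule holomorphic_on_subset[OF holomorphic_on_det[OF schur_classD(1)[OF H]]]) (use r in auto)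
  note mv = circle_log_mean_value[OF hol nz r(1,2)]
  have le1: "cmod (?f (of_real r * t)) \<le> 1" if "cmod t = 1" for t
    using that r by (intro det_contractive_le_1 schur_classD(2)[OF H]) (simp add: norm_mult)
  have pos: "cmod (?f (of_real r * t)) > 0" if "cmod t = 1" for t
    using nz[of "of_real r * t"] that r by (simp add: norm_mult)
  have "ennreal (- ln (cmod (?f 0))) = ennreal (LINT t|circle_measure. - ln (cmod (?f (of_real r * t))))"
    using mv by simp
  also have "\<dots> = (\<integral>\<^sup>+t. ennreal (- ln (cmod (?f (of_real r * t)))) \<partial>circle_measure)"
    using mv(2) le1 pos by (intro nn_integral_eq_integral[symmetric] AE_I2) auto
  also have "\<dots> \<le> (\<integral>\<^sup>+t. log_deficit 1 (d (of_real r * t)) \<partial>circle_measure)"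
  proof (rule nn_integral_mono)
    fix t assume "t \<in> space circle_measure"
    then have t: "cmod t = 1" by simp
    have "ennreal (- ln (cmod (?f (of_real r * t)))) = log_deficit 1 (cmod (?f (of_real r * t)))"
      using pos[OF t] by (simp add: log_deficit_def)
    also have "\<dots> \<le> log_deficit 1 (d (of_real r * t))"
      using t r by (intro log_deficit_antimono le d0) (simp add: norm_mult)
    finally show "ennreal (- ln (cmod (?f (of_real r * t)))) \<le> log_deficit 1 (d (of_real r * t))" .
  qed
  also have "\<dots> \<le> ennreal \<epsilon>" by (rule int)
  finally have "- ln (cmod (?f 0)) \<le> \<epsilon>" using \<epsilon> by simp
  then have "exp (- \<epsilon>) \<le> exp (ln (cmod (?f 0)))" by simp
  also have "\<dots> = cmod (?f 0)" using nz[of 0] r by (intro exp_ln) auto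
  finally show ?thesis .
qed

section \<open>Products of rank-one Blaschke-Potapov factors\<close>

lemma right_bp_partial_cong:
  assumes "\<And>k. k < N \<Longrightarrow> a k = a' k \<and> P k = P' k"
  shows "right_bp_partial a P N z = right_bp_partial a' P' N z"
  using assms by (induction N) auto

lemma contractive_bp_factor_rank_one:
  assumes "cmod a < 1" "norm v = 1" "cmod z < 1"
  shows "contractive (bp_factor a (rank_one v) z)"
  unfolding bp_factor_rank_one using assms
  by (intro contractive_rank_one_update) (auto intro: norm_blaschke_factor_le_1)

lemma contractive_right_bp_partial:
  assumes "\<And>k. k < N \<Longrightarrow> cmod (a k) < 1 \<and> norm (v k) = 1" "cmod z < 1"
  shows "contractive (right_bp_partial a (\<lambda>k. rank_one (v k)) N z)"
  using assms
  by (induction N) (auto intro!: contractive_mat_1 contractive_mult contractive_bp_factor_rank_one)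

text \<open>The unit vector \<open>v\<close> is an eigenvector of the factor with eigenvalue
  \<open>blaschke_factor a z\<close>, so the determinant bound for contractions applies.\<close>

lemma det_bp_factor_rank_one_le:
  assumes "cmod a < 1" "norm v = 1" "cmod z < 1"
  shows "cmod (det (bp_factor a (rank_one v) z)) \<le> cmod (blaschke_factor a z)"
proof -
  have "bp_factor a (rank_one v) z *v v = blaschke_factor a z *s v"
    using assms(2)
    by (simp add: bp_factor_rank_one rank_one_update_mult_vec cinner_self vec_eq_iff algebra_simps)
  then have "norm (bp_factor a (rank_one v) z *v v) = cmod (blaschke_factor a z)"
    using assms(2) by (simp add: norm_cscale)
  then show ?thesis
    using det_contractive_le_norm[OF contractive_bp_factor_rank_one[OF assms] assms(2)] by simp
qed

lemma bp_data_rank_one: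
  assumes "cmod a < 1" "norm v = 1" shows "bp_data a (rank_one v)"
proof -
  have vv: "rank_one v *v x = cinner x v *s v" for x
    by (simp add: vec_eq_iff rank_one_def matrix_vector_mult_def cinner_def sum_distrib_left mult_ac)
  have "rank_one v *v v = v" using assms by (simp add: vv cinner_self)
  then have "rank_one v \<noteq> 0" using assms by (metis matrix_vector_mult_0 norm_zero zero_neq_one)
  moreover have "(rank_one v ** rank_one v) *v x = rank_one v *v x" for x
    using assms by (simp add: vv cinner_scale_left cinner_self flip: matrix_vector_mul_assoc)
  then have "rank_one v ** rank_one v = rank_one v" by (simp add: matrix_eq)
  moreover have "adjoint_matrix (rank_one v) = rank_one v"
    by (simp add: adjoint_matrix_def rank_one_def mult.commute)
  ultimately show ?thesis using assms by (simp add: bp_data_def orthogonal_projection_matrix_def)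
qed

lemma trace_rank_one:
  assumes "norm v = 1" shows "trace (rank_one v) = 1"
  using assms cinner_self[of v] by (simp add: trace_def rank_one_def cinner_def)

lemma schur_class_constant:
  assumes G: "G \<in> schur_class" and "cmod (det (G 0)) = 1" and z: "cmod z < 1"
  shows "G z = G 0"
proof -
  have "(norm (G z *v axis j 1 - G 0 *v axis j 1))\<^sup>2 \<le> 0" for j
    using schur_class_rigidity[OF G norm_axis_unit[of j] z] assms(2) by simp
  then have "G z *v axis j 1 = G 0 *v axis j 1" for j by simp
  then have "column j (G z) = column j (G 0)" for j
    by (simp add: matrix_vector_mult_def axis_def column_def if_distrib[of "\<lambda>x. _ * x"] vec_eq_iff cong: if_cong)
  then show ?thesis by (simp add: column_def vec_eq_iff)
qed

lemma minimal_zero_exists: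
  assumes f: "f holomorphic_on unit_disc" and w: "cmod w < 1" "f w = 0"
  obtains a where "cmod a < 1" "f a = 0" "\<And>z. cmod z < 1 \<Longrightarrow> f z = 0 \<Longrightarrow> cmod a \<le> cmod z"
proof -
  define Z where "Z = {z \<in> cball 0 (cmod w). f z = 0}"
  have "continuous_on (cball 0 (cmod w)) f"
    using w by (intro continuous_on_subset[OF holomorphic_on_imp_continuous_on[OF f]]) auto
  then have "closed Z" unfolding Z_def
    by (intro continuous_closed_preimage_constant) auto
  moreover have "bounded Z" by (rule bounded_subset[OF bounded_cball[of 0 "cmod w"]]) (auto simp: Z_def)
  ultimately have "compact Z" by (simp add: compact_eq_bounded_closed)
  moreover have "w \<in> Z" using w by (simp add: Z_def)
  ultimately obtain a where a: "a \<in> Z" "\<And>z. z \<in> Z \<Longrightarrow> cmod a \<le> cmod z"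
    using continuous_attains_inf[of Z cmod] continuous_on_norm_id by blast
  show ?thesis
  proof (rule that[of a])
    show "cmod a \<le> cmod z" if "cmod z < 1" "f z = 0" for z
      using a that by (cases "cmod z \<le> cmod w") (auto simp: Z_def)
    show "cmod a < 1" using a(2)[OF \<open>w \<in> Z\<close>] w by linarith
  qed (use a in \<open>auto simp: Z_def\<close>)
qed

lemma tendsto_det:
  fixes A :: "'a \<Rightarrow> complex ^ 'n ^ 'n"
  assumes "(A \<longlongrightarrow> B) F" shows "((\<lambda>x. det (A x)) \<longlongrightarrow> det B) F"
  unfolding det_def by (intro tendsto_intros assms)

lemma tendsto_mult_vec:
  fixes A :: "'a \<Rightarrow> complex ^ 'n ^ 'n"
  assumes "(A \<longlongrightarrow> B) F" shows "((\<lambda>x. A x *v y) \<longlongrightarrow> B *v y) F"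
  unfolding matrix_vector_mult_def
  by (rule vec_tendstoI) (simp, intro tendsto_intros assms)

lemma matrix_tendstoI:
  fixes A :: "'a \<Rightarrow> complex ^ 'n ^ 'n"
  assumes "\<And>i j. ((\<lambda>x. A x $ i $ j) \<longlongrightarrow> B $ i $ j) F" shows "(A \<longlongrightarrow> B) F"
  by (intro vec_tendstoI assms)

text \<open>All projections have rank one, so every trace in the Blaschke condition is 1; points may
  repeat, which covers projections of higher rank. Only the first \<open>N\<close> entries of the
  infinite sequences matter, so one pair of sequences can serve all \<open>N\<close>.\<close>

definition partial_factorization ::
    "(complex \<Rightarrow> complex ^ 'n ^ 'n) \<Rightarrow> (nat \<Rightarrow> complex) \<Rightarrow> (nat \<Rightarrow> complex ^ 'n) \<Rightarrow> nat \<Rightarrow>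
     (complex \<Rightarrow> complex ^ 'n ^ 'n) \<Rightarrow> bool" where
  "partial_factorization T a v N H \<longleftrightarrow> H \<in> schur_class \<and>
     (\<forall>k<N. cmod (a k) < 1 \<and> norm (v k) = 1) \<and>
     (\<forall>z. cmod z < 1 \<longrightarrow> T z = H z ** right_bp_partial a (\<lambda>k. rank_one (v k)) N z)"

lemma partial_factorization_det:
  assumes "partial_factorization T a v N H" "cmod z < 1"
  shows "det (T z) = det (H z) * det (right_bp_partial a (\<lambda>k. rank_one (v k)) N z)"
    and "cmod (det (T z)) \<le> cmod (det (H z))"
proof -
  show eq: "det (T z) = det (H z) * det (right_bp_partial a (\<lambda>k. rank_one (v k)) N z)"
    using assms by (simp add: partial_factorization_def det_mul)
  have "cmod (det (right_bp_partial a (\<lambda>k. rank_one (v k)) N z)) \<le> 1"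
    using assms by (intro det_contractive_le_1 contractive_right_bp_partial)
      (auto simp: partial_factorization_def)
  then show "cmod (det (T z)) \<le> cmod (det (H z))"
    by (simp add: eq norm_mult mult_left_le)
qed

lemma finite_factorization_blaschke_potapov:
  assumes pf: "partial_factorization T a v N H" and det: "cmod (det (H 0)) = 1"
  shows "right_blaschke_potapov T"
proof -
  have H: "H \<in> schur_class" using pf by (simp add: partial_factorization_def)
  have "unitary_matrix (H 0)"
    by (rule contractive_det_1_unitary[OF schur_classD(2)[OF H] det]) simp
  moreover have "\<forall>z\<in>unit_disc. T z = H 0 ** right_bp_partial a (\<lambda>k. rank_one (v k)) N z"
  proof
    fix z :: complex assume "z \<in> unit_disc"
    then have z: "cmod z < 1" by simp
    then have "T z = H z ** right_bp_partial a (\<lambda>k. rank_one (v k)) N z"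
      using pf by (simp add: partial_factorization_def)
    then show "T z = H 0 ** right_bp_partial a (\<lambda>k. rank_one (v k)) N z"
      unfolding schur_class_constant[OF H det z] .
  qed
  moreover have "\<forall>k<N. bp_data (a k) (rank_one (v k))"
    using pf by (simp add: partial_factorization_def bp_data_rank_one)
  ultimately show ?thesis unfolding right_blaschke_potapov_def
    by (intro exI[of _ "H 0"] exI[of _ a] exI[of _ "\<lambda>k. rank_one (v k)"] conjI disjI1 exI[of _ N])
qed

text \<open>Since \<open>b \<le> exp (- (1 - b))\<close>, the partial products give
  \<open>|det (T z)| \<le> exp (- S)\<close>, where \<open>S\<close> is the sum of
  \<open>1 - |b_k(z)|\<close>. So these sums stay bounded, and they dominate a fixed multiple of the
  sums of \<open>1 - |a_k|\<close>.\<close>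

lemma blaschke_condition:
  fixes T :: "complex \<Rightarrow> complex ^ 'n ^ 'n"
  assumes pf: "\<And>N. partial_factorization T a v N (H N)" and z: "cmod z < 1" "det (T z) \<noteq> 0"
  shows "summable (\<lambda>k. 1 - cmod (a k))"
proof -
  let ?b = "\<lambda>k. cmod (blaschke_factor (a k) z)"
  let ?R = "right_bp_partial a (\<lambda>k. rank_one (v k))"
  have a: "cmod (a k) < 1" and v: "norm (v k) = 1" for k
    using pf[of "Suc k"] by (auto simp: partial_factorization_def)
  have R: "cmod (det (?R N z)) \<le> exp (- (\<Sum>k<N. 1 - ?b k))" for N
  proof (induction N)
    case (Suc N)
    have "cmod (det (bp_factor (a N) (rank_one (v N)) z)) \<le> exp (- (1 - ?b N))"
      using det_bp_factor_rank_one_le[OF a v z(1), of N N] exp_ge_add_one_self[of "?b N - 1"] by simp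
    then have "cmod (det (?R (Suc N) z)) \<le> exp (- (1 - ?b N)) * exp (- (\<Sum>k<N. 1 - ?b k))"
      using Suc by (simp add: det_mul norm_mult mult_mono)
    also have "\<dots> = exp (- (\<Sum>k<Suc N. 1 - ?b k))" by (simp flip: exp_add)
    finally show ?case .
  qed simp
  have c: "0 < (1 - (cmod z)\<^sup>2) / 8" using z(1) by (simp add: power_less_one_iff abs_square_less_1)
  have bound: "(\<Sum>k<N. 1 - cmod (a k)) \<le> - ln (cmod (det (T z))) / ((1 - (cmod z)\<^sup>2) / 8)" for N
  proof -
    have "cmod (det (H N z)) \<le> 1"
      using pf[of N] z(1) by (intro det_contractive_le_1 schur_classD(2)) (auto simp: partial_factorization_def)
    then have "cmod (det (T z)) \<le> cmod (det (?R N z))"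
      unfolding partial_factorization_det(1)[OF pf z(1), of N] norm_mult by (simp add: mult_left_le_one_le)
    also note R
    finally have "ln (cmod (det (T z))) \<le> ln (exp (- (\<Sum>k<N. 1 - ?b k)))"
      using z(2) by (subst ln_le_cancel_iff) simp_all
    then have "(\<Sum>k<N. 1 - ?b k) \<le> - ln (cmod (det (T z)))"
      unfolding ln_exp by linarith
    moreover have "(\<Sum>k<N. (1 - cmod (a k)) * ((1 - (cmod z)\<^sup>2) / 8)) \<le> (\<Sum>k<N. 1 - ?b k)"
      by (intro sum_mono one_minus_norm_blaschke_factor_ge a z)
    ultimately have "(\<Sum>k<N. 1 - cmod (a k)) * ((1 - (cmod z)\<^sup>2) / 8) \<le> - ln (cmod (det (T z)))"
      by (simp only: sum_distrib_right)
    then show ?thesis using c by (simp only: pos_le_divide_eq)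
  qed
  show ?thesis
    by (rule summableI_nonneg_bounded[OF _ bound]) (simp add: a less_imp_le)
qed

text \<open>Determinants tending to 1 in modulus do not force the matrices \<open>H N 0\<close> to
  converge, since they might drift among nearly unitary ones. The Blaschke condition prevents this:
  consecutive values differ by a multiple of \<open>1 - |a_N|\<close>. The limit \<open>V\<close> is
  then unitary, rigidity carries the convergence from 0 to every \<open>z\<close>, and boundedness
  of the partial products lets \<open>V\<close> replace \<open>H N z\<close>.\<close>

lemma infinite_factorization_blaschke_potapov:
  fixes T :: "complex \<Rightarrow> complex ^ 'n ^ 'n"
  assumes pf: "\<And>N. partial_factorization T a v N (H N)"
    and step: "\<And>N z. cmod z < 1 \<Longrightarrow> H N z = H (Suc N) z ** bp_factor (a N) (rank_one (v N)) z"
    and summ: "summable (\<lambda>k. 1 - cmod (a k))"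
    and det: "(\<lambda>N. cmod (det (H N 0))) \<longlonglongrightarrow> 1"
  shows "right_blaschke_potapov T"
proof -
  let ?R = "right_bp_partial a (\<lambda>k. rank_one (v k))"
  have a: "cmod (a k) < 1" and v: "norm (v k) = 1" for k
    using pf[of "Suc k"] by (auto simp: partial_factorization_def)
  have H: "H N \<in> schur_class" for N using pf by (simp add: partial_factorization_def)
  have conv: "convergent (\<lambda>N. H N 0 *v axis j 1)" for j
  proof -
    let ?x = "axis j 1 :: complex ^ 'n"
    let ?D = "\<lambda>N. H (Suc N) 0 *v ?x - H N 0 *v ?x"
    have "summable ?D"
    proof (rule summable_comparison_test'[where N = 0])
      show "summable (\<lambda>k. (1 - cmod (a k)) * 2)" by (intro summable_mult2 summ)
      fix N :: nat
      let ?\<beta> = "blaschke_factor (a N) 0 - 1"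
      have "H N 0 *v ?x = H (Suc N) 0 *v ?x + H (Suc N) 0 *v ((?\<beta> * cinner ?x (v N)) *s v N)"
        unfolding step[of 0 N, simplified]
        by (simp add: bp_factor_rank_one rank_one_update_mult_vec matrix_vector_right_distrib
            flip: matrix_vector_mul_assoc)
      then have "norm (?D N) \<le> norm ((?\<beta> * cinner ?x (v N)) *s v N)"
        using contractiveD[OF schur_classD(2)[OF H[of "Suc N"], of 0]] by simp
      also have "\<dots> = cmod ?\<beta> * cmod (cinner ?x (v N))" by (simp add: norm_cscale v norm_mult)
      also have "\<dots> \<le> cmod ?\<beta> * 1"
        using cmod_cinner_le[of ?x "v N"] by (intro mult_left_mono) (auto simp: v norm_axis_unit)
      also have "\<dots> \<le> (1 - cmod (a N)) * 2"
        using one_minus_blaschke_factor_le[of "a N" 0] a by simp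
      finally show "norm (?D N) \<le> (1 - cmod (a N)) * 2" .
    qed
    then have "convergent (\<lambda>n. (\<Sum>N<n. ?D N) + H 0 0 *v ?x)"
      unfolding summable_iff_convergent by (intro convergent_add convergent_const)
    then show ?thesis by (simp add: sum_lessThan_telescope[where f = "\<lambda>N. H N 0 *v ?x"])
  qed
  have entry: "(A *v axis j 1) $ i = A $ i $ j" for A :: "complex ^ 'n ^ 'n" and i j
    by (simp add: matrix_vector_mult_def axis_def if_distrib[of "\<lambda>x. _ * x"] cong: if_cong)
  define V where "V = (\<chi> i j. lim (\<lambda>N. H N 0 *v axis j 1) $ i)"
  have H0: "(\<lambda>N. H N 0) \<longlonglongrightarrow> V"
  proof (rule matrix_tendstoI)
    fix i j
    have "(\<lambda>N. (H N 0 *v axis j 1) $ i) \<longlonglongrightarrow> lim (\<lambda>N. H N 0 *v axis j 1) $ i"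
      by (intro tendsto_vec_nth) (use conv convergent_LIMSEQ_iff in blast)
    then show "(\<lambda>N. H N 0 $ i $ j) \<longlonglongrightarrow> V $ i $ j" by (simp add: entry V_def)
  qed
  have "contractive V"
    unfolding contractive_def
  proof
    fix x
    have "(\<lambda>N. norm (H N 0 *v x)) \<longlonglongrightarrow> norm (V *v x)"
      by (intro tendsto_norm tendsto_mult_vec H0)
    then show "norm (V *v x) \<le> norm x"
      by (rule tendsto_upperbound) (auto intro!: always_eventually contractiveD schur_classD(2)[OF H])
  qed
  moreover have "(\<lambda>N. cmod (det (H N 0))) \<longlonglongrightarrow> cmod (det V)"
    by (intro tendsto_norm tendsto_det H0)
  then have "cmod (det V) = 1" using det LIMSEQ_unique by blast
  ultimately have V: "unitary_matrix V" by (rule contractive_det_1_unitary)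
  have Hz: "(\<lambda>N. H N z) \<longlonglongrightarrow> V" if z: "cmod z < 1" for z
  proof (rule matrix_tendstoI)
    fix i j
    have "(\<lambda>N. (norm (H N z *v axis j 1 - H N 0 *v axis j 1))\<^sup>2) \<longlonglongrightarrow> 0"
    proof (rule tendsto_sandwich[OF _ _ tendsto_const])
      show "\<forall>\<^sub>F N in sequentially. (norm (H N z *v axis j 1 - H N 0 *v axis j 1))\<^sup>2
          \<le> (1 - (cmod (det (H N 0)))\<^sup>2) * (1 + 2 / (1 - cmod z))"
        by (intro always_eventually allI schur_class_rigidity H norm_axis_unit z)
      have "(\<lambda>N. (1 - (cmod (det (H N 0)))\<^sup>2) * (1 + 2 / (1 - cmod z)))
          \<longlonglongrightarrow> (1 - 1\<^sup>2) * (1 + 2 / (1 - cmod z))"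
        by (intro tendsto_mult_right tendsto_diff tendsto_const tendsto_power det)
      then show "(\<lambda>N. (1 - (cmod (det (H N 0)))\<^sup>2) * (1 + 2 / (1 - cmod z))) \<longlonglongrightarrow> 0" by simp
    qed auto
    then have "(\<lambda>N. sqrt ((norm (H N z *v axis j 1 - H N 0 *v axis j 1))\<^sup>2)) \<longlonglongrightarrow> sqrt 0"
      by (rule tendsto_real_sqrt)
    then have "(\<lambda>N. H N z *v axis j 1 - H N 0 *v axis j 1) \<longlonglongrightarrow> 0"
      by (simp add: tendsto_norm_zero_iff)
    then have "(\<lambda>N. (H N z *v axis j 1 - H N 0 *v axis j 1) $ i) \<longlonglongrightarrow> 0 $ i"
      by (rule tendsto_vec_nth)
    then have "(\<lambda>N. H N z $ i $ j - H N 0 $ i $ j) \<longlonglongrightarrow> 0" by (simp add: entry)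
    moreover have "(\<lambda>N. H N 0 $ i $ j) \<longlonglongrightarrow> V $ i $ j" by (intro tendsto_vec_nth H0)
    ultimately show "(\<lambda>N. H N z $ i $ j) \<longlonglongrightarrow> V $ i $ j"
      using tendsto_add by fastforce
  qed
  have "(\<lambda>N. V ** ?R N z) \<longlonglongrightarrow> T z" if z: "cmod z < 1" for z
  proof (rule matrix_tendstoI)
    fix i j
    have "(\<lambda>N. \<Sum>k\<in>UNIV. (V $ i $ k - H N z $ i $ k) * ?R N z $ k $ j) \<longlonglongrightarrow> (\<Sum>k\<in>(UNIV :: 'n set). 0)"
    proof (intro tendsto_sum)
      fix k
      have "(\<lambda>N. V $ i $ k - H N z $ i $ k) \<longlonglongrightarrow> V $ i $ k - V $ i $ k"
        by (intro tendsto_diff tendsto_const tendsto_vec_nth Hz z)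
      then have 0: "(\<lambda>N. cmod (V $ i $ k - H N z $ i $ k)) \<longlonglongrightarrow> 0"
        by (simp add: tendsto_norm_zero_iff)
      show "(\<lambda>N. (V $ i $ k - H N z $ i $ k) * ?R N z $ k $ j) \<longlonglongrightarrow> 0"
      proof (rule Lim_null_comparison[OF _ 0], intro always_eventually allI)
        fix N
        have "cmod (?R N z $ k $ j) \<le> 1"
          by (intro contractive_entry contractive_right_bp_partial) (auto simp: a v z)
        then show "cmod ((V $ i $ k - H N z $ i $ k) * ?R N z $ k $ j) \<le> cmod (V $ i $ k - H N z $ i $ k)"
          by (simp add: norm_mult mult_left_le)
      qed
    qed
    moreover have "(\<Sum>k\<in>UNIV. (V $ i $ k - H N z $ i $ k) * ?R N z $ k $ j) = (V ** ?R N z) $ i $ j - T z $ i $ j" for N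
    proof -
      have "T z = H N z ** ?R N z" using pf z by (simp add: partial_factorization_def)
      then show ?thesis by (simp add: matrix_matrix_mult_def left_diff_distrib sum_subtractf)
    qed
    ultimately have "(\<lambda>N. (V ** ?R N z) $ i $ j - T z $ i $ j) \<longlonglongrightarrow> 0" by simp
    then show "(\<lambda>N. (V ** ?R N z) $ i $ j) \<longlonglongrightarrow> T z $ i $ j"
      by (rule LIM_zero_cancel)
  qed
  moreover have "summable (\<lambda>k. complex_of_real (1 - cmod (a k)) * trace (rank_one (v k)))"
    using summable_of_real[OF summ] by (simp add: trace_rank_one v)
  moreover have "\<forall>k. bp_data (a k) (rank_one (v k))" by (intro allI bp_data_rank_one a v)
  ultimately show ?thesis
    unfolding right_blaschke_potapov_def using V
    by (intro exI[of _ V] exI[of _ a] exI[of _ "\<lambda>k. rank_one (v k)"] conjI disjI2) auto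
qed

text \<open>Either some splitting reaches a zero-free determinant, and the remainder is a unitary
  constant, or splitting never stops and yields an infinite product. One good radius for each
  \<epsilon> suffices, because the mean value property transports the bound directly to 0.\<close>

lemma schur_class_blaschke_potapov:
  fixes T :: "complex \<Rightarrow> complex ^ 'n ^ 'n"
  assumes T: "T \<in> schur_class" and w: "cmod w < 1" "det (T w) \<noteq> 0"
    and lim: "\<And>\<epsilon>. 0 < \<epsilon> \<Longrightarrow> \<exists>r. 0 \<le> r \<and> r < 1 \<and>
      (\<integral>\<^sup>+t. log_deficit 1 (cmod (det (T (of_real r * t)))) \<partial>circle_measure) \<le> ennreal \<epsilon>"
  shows "right_blaschke_potapov T"
proof -
  have le1: "cmod (det (H 0)) \<le> 1" if "partial_factorization T a v N H" for a v N H
    using that by (intro det_contractive_le_1 schur_classD(2)) (auto simp: partial_factorization_def)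
  show ?thesis
  proof (cases "\<exists>a v N H. partial_factorization T a v N H \<and> (\<forall>z. cmod z < 1 \<longrightarrow> det (H z) \<noteq> 0)")
    case True
    then obtain a v N H where pf: "partial_factorization T a v N H"
      and nz: "\<And>z. cmod z < 1 \<Longrightarrow> det (H z) \<noteq> 0" by blast
    have H: "H \<in> schur_class" using pf by (simp add: partial_factorization_def)
    have ge: "exp (- \<epsilon>) \<le> cmod (det (H 0))" if \<epsilon>: "0 < \<epsilon>" for \<epsilon>
    proof -
      obtain r where "0 \<le> r" "r < 1"
        "(\<integral>\<^sup>+t. log_deficit 1 (cmod (det (T (of_real r * t)))) \<partial>circle_measure) \<le> ennreal \<epsilon>"
        using lim[OF \<epsilon>] by blast
      then show ?thesis
        using \<epsilon> by (intro det_schur_at_origin_ge[OF H _ _ order_refl nz partial_factorization_det(2)[OF pf]]) auto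
    qed
    have "((\<lambda>\<epsilon>. exp (- \<epsilon>)) \<longlongrightarrow> exp (- 0)) (at_right (0::real))" by (intro tendsto_intros)
    then have "exp (- 0) \<le> cmod (det (H 0))"
      by (rule tendsto_upperbound)
        (auto intro!: eventually_at_rightI[of 0 1] ge)
    then show ?thesis
      using le1[OF pf] by (intro finite_factorization_blaschke_potapov[OF pf]) simp
  next
    case False
    define Q where "Q H a v H' \<longleftrightarrow> cmod a < 1 \<and> norm v = 1 \<and>
      (\<forall>z. cmod z < 1 \<longrightarrow> det (H z) = 0 \<longrightarrow> cmod a \<le> cmod z) \<and>
      (\<forall>z. cmod z < 1 \<longrightarrow> H z = H' z ** bp_factor a (rank_one v) z)"
      for H H' :: "complex \<Rightarrow> complex ^ 'n ^ 'n" and a v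
    \<comment> \<open>Dependent choice produces \<open>H\<close> alone; that it stems from some
      finite factorization is kept existentially. The sequences \<open>a\<close> and
      \<open>v\<close> are read off afterwards from \<open>Q\<close>, and the factorization along
      them follows by induction from \<open>H 0 = T\<close>.\<close>
    define P where "P N H \<longleftrightarrow> (N = 0 \<longrightarrow> H = T) \<and> (\<exists>a v. partial_factorization T a v N H)" for N H
    have "\<exists>H. \<forall>N. P N (H N) \<and> (\<exists>a v. Q (H N) a v (H (Suc N)))"
    proof (rule dependent_nat_choice)
      have "partial_factorization T (\<lambda>_. 0) (\<lambda>_. 0) 0 T" using T by (simp add: partial_factorization_def)
      then show "\<exists>H. P 0 H" unfolding P_def by blast
    next
      fix H N assume "P N H"
      then obtain a v where pf: "partial_factorization T a v N H" unfolding P_def by blast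
      then have H: "H \<in> schur_class" by (simp add: partial_factorization_def)
      obtain w' where "cmod w' < 1" "det (H w') = 0" using False pf by blast
      with minimal_zero_exists[OF holomorphic_on_det[OF schur_classD(1)[OF H]]]
      obtain b where b: "cmod b < 1" "det (H b) = 0"
        "\<And>z. cmod z < 1 \<Longrightarrow> det (H z) = 0 \<Longrightarrow> cmod b \<le> cmod z"
        by blast
      obtain H' u where H': "H' \<in> schur_class" "norm u = 1"
        "\<And>z. cmod z < 1 \<Longrightarrow> H z = H' z ** bp_factor b (rank_one u) z"
        using schur_class_split_factor[OF H b(1,2)] by blast
      have "right_bp_partial (a(N := b)) (\<lambda>k. rank_one ((v(N := u)) k)) N z =
          right_bp_partial a (\<lambda>k. rank_one (v k)) N z" for z
        by (rule right_bp_partial_cong) auto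
      then have "partial_factorization T (a(N := b)) (v(N := u)) (Suc N) H'"
        using pf b(1) H' by (simp add: partial_factorization_def matrix_mul_assoc less_Suc_eq)
      moreover have "Q H b u H'" using b H' by (simp add: Q_def)
      ultimately show "\<exists>H'. P (Suc N) H' \<and> (\<exists>a v. Q H a v H')" unfolding P_def by blast
    qed
    then obtain H where P: "\<And>N. P N (H N)" and ex: "\<forall>N. \<exists>a v. Q (H N) a v (H (Suc N))" by blast
    from ex obtain a v where Q: "\<And>N. Q (H N) (a N) (v N) (H (Suc N))" by metis
    have H: "H N \<in> schur_class" for N
      using P[of N] unfolding P_def partial_factorization_def by blast
    have pf: "partial_factorization T a v N (H N)" for N
    proof -
      have "T z = H N z ** right_bp_partial a (\<lambda>k. rank_one (v k)) N z" if "cmod z < 1" for z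
      proof (induction N)
        case 0 then show ?case using P[of 0] by (simp add: P_def)
      next
        case (Suc N) then show ?case using Q[of N] that by (simp add: Q_def matrix_mul_assoc)
      qed
      moreover have "cmod (a k) < 1" "norm (v k) = 1" for k using Q[of k] by (simp_all add: Q_def)
      ultimately show ?thesis using H by (simp add: partial_factorization_def)
    qed
    have summ: "summable (\<lambda>k. 1 - cmod (a k))" by (rule blaschke_condition[OF pf w])
    have "(\<lambda>k. 1 - (1 - cmod (a k))) \<longlonglongrightarrow> 1 - 0"
      by (intro tendsto_diff tendsto_const summable_LIMSEQ_zero summ)
    then have a1: "(\<lambda>k. cmod (a k)) \<longlonglongrightarrow> 1" by simp
    have "(\<lambda>N. cmod (det (H N 0))) \<longlonglongrightarrow> 1"
    proof (rule order_tendstoI)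
      fix y :: real assume "1 < y"
      then show "\<forall>\<^sub>F N in sequentially. cmod (det (H N 0)) < y"
        by (intro always_eventually allI le_less_trans[OF le1[OF pf]])
    next
      fix y :: real assume y: "y < 1"
      \<comment> \<open>Then \<open>exp (- \<epsilon>)\<close> is the square root of
        \<open>max y (1/2)\<close>, which exceeds \<open>y\<close>; the \<open>1/2\<close> keeps the
        logarithm meaningful for \<open>y \<le> 0\<close>.\<close>
      define \<epsilon> where "\<epsilon> = - ln (max y (1/2)) / 2"
      have \<epsilon>: "0 < \<epsilon>" using y by (simp add: \<epsilon>_def)
      have "y < exp (- \<epsilon>)"
      proof -
        have "ln (max y (1/2)) < - \<epsilon>" using \<epsilon> by (simp add: \<epsilon>_def)
        then have "exp (ln (max y (1/2))) < exp (- \<epsilon>)" by (subst exp_less_cancel_iff)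
        moreover have "exp (ln (max y (1/2))) = max y (1/2)" by (rule exp_ln) simp
        ultimately show ?thesis by linarith
      qed
      obtain r where r: "0 \<le> r" "r < 1"
        "(\<integral>\<^sup>+t. log_deficit 1 (cmod (det (T (of_real r * t)))) \<partial>circle_measure) \<le> ennreal \<epsilon>"
        using lim[OF \<epsilon>] by blast
      \<comment> \<open>Once \<open>|a N|\<close> exceeds \<open>r\<close>, minimality of
        \<open>a N\<close> among the zeros of \<open>det (H N)\<close> places the circle of radius
        \<open>r\<close> in a zero-free disc.\<close>
      have "\<forall>\<^sub>F N in sequentially. r < cmod (a N)" using a1 r(2) by (rule order_tendstoD)
      then show "\<forall>\<^sub>F N in sequentially. y < cmod (det (H N 0))"
      proof eventually_elim
        case (elim N)
        have "exp (- \<epsilon>) \<le> cmod (det (H N 0))"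
        proof (rule det_schur_at_origin_ge[OF H r(1) elim _ _ partial_factorization_det(2)[OF pf]])
          show a1: "cmod (a N) \<le> 1" using Q[of N] unfolding Q_def by simp
          fix z assume z: "cmod z < cmod (a N)"
          then have "cmod z < 1" using a1 by linarith
          then show "det (H N z) \<noteq> 0" using Q[of N] z unfolding Q_def by (meson not_less)
        qed (use r \<epsilon> in auto)
        with \<open>y < exp (- \<epsilon>)\<close> show ?case by linarith
      qed
    qed
    moreover have "H N z = H (Suc N) z ** bp_factor (a N) (rank_one (v N)) z" if "cmod z < 1" for N z
      using Q[of N] that by (simp add: Q_def)
    ultimately show ?thesis using infinite_factorization_blaschke_potapov[OF pf _ summ] by blast
  qed
qed

section \<open>Measures with continuous potential\<close>

lemma measurable_log_deficit [measurable]: "log_deficit \<delta> \<in> borel_measurable borel"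
  unfolding log_deficit_def by measurable

lemma log_deficit_mono_left:
  assumes "0 < \<delta>" "\<delta> \<le> \<delta>'" shows "log_deficit \<delta> x \<le> log_deficit \<delta>' x"
  using assms by (auto simp: log_deficit_def intro!: ennreal_leI)

lemma ennreal_add_le: "ennreal (a + b) \<le> ennreal a + ennreal b"
proof (cases "0 \<le> a \<and> 0 \<le> b")
  case True then show ?thesis by simp
next
  case False
  then have "ennreal (a + b) \<le> ennreal a \<or> ennreal (a + b) \<le> ennreal b"
    by (auto intro!: ennreal_leI)
  then show ?thesis by (meson add_increasing add_increasing2 zero_le)
qed

lemma log_deficit_mult_le:
  assumes "0 < \<delta>" "0 < \<delta>'" "0 \<le> x" "0 \<le> y"
  shows "log_deficit (\<delta> * \<delta>') (x * y) \<le> log_deficit \<delta> x + log_deficit \<delta>' y"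
proof (cases "x = 0 \<or> y = 0")
  case True
  then show ?thesis by (auto simp: log_deficit_def)
next
  case False
  then have "ln (\<delta> * \<delta>') - ln (x * y) = (ln \<delta> - ln x) + (ln \<delta>' - ln y)"
    using assms by (simp add: ln_mult)
  then show ?thesis
    using False ennreal_add_le[of "ln \<delta> - ln x" "ln \<delta>' - ln y"] by (simp add: log_deficit_def)
qed

text \<open>\<open>ln\<close> has Lipschitz constant \<open>1 / \<epsilon>\<close> above \<epsilon>;
  this makes truncated potentials continuous.\<close>

lemma abs_ln_max_diff_le:
  fixes x y \<epsilon> :: real
  assumes "0 < \<epsilon>" shows "\<bar>ln (max \<epsilon> x) - ln (max \<epsilon> y)\<bar> \<le> \<bar>x - y\<bar> / \<epsilon>"
proof -
  have le: "ln u - ln v \<le> (u - v) / \<epsilon>" if "\<epsilon> \<le> v" "v \<le> u" for u v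
  proof -
    have "0 < v" "0 < u" using assms that by linarith+
    then have "ln u - ln v = ln (u / v)" by (simp add: ln_div)
    also have "\<dots> \<le> u / v - 1" using \<open>0 < u\<close> \<open>0 < v\<close> by (intro ln_le_minus_one) simp
    also have "\<dots> = (u - v) / v" using \<open>0 < v\<close> by (simp add: field_simps)
    also have "\<dots> \<le> (u - v) / \<epsilon>" using assms that by (intro divide_left_mono mult_pos_pos) auto
    finally show ?thesis .
  qed
  let ?u = "max \<epsilon> x" and ?v = "max \<epsilon> y"
  have "\<bar>ln ?u - ln ?v\<bar> \<le> \<bar>?u - ?v\<bar> / \<epsilon>"
  proof -
    have "\<bar>ln u - ln v\<bar> \<le> \<bar>u - v\<bar> / \<epsilon>" if "\<epsilon> \<le> v" "v \<le> u" for u v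
    proof -
      have "ln v \<le> ln u" using assms that by (subst ln_le_cancel_iff) auto
      then show ?thesis using le[OF that] that by simp
    qed
    from this[of ?v ?u] this[of ?u ?v] show ?thesis
      by (cases "?v \<le> ?u") (auto simp only: abs_minus_commute max.cobounded1 linear)
  qed
  also have "\<dots> \<le> \<bar>x - y\<bar> / \<epsilon>" using assms by (intro divide_right_mono) auto
  finally show ?thesis .
qed

section \<open>Truncated logarithmic potentials\<close>

locale continuous_potential =
  fixes \<nu> :: "complex measure" and K :: "complex set"
  assumes sets_nu: "sets \<nu> = sets borel" and finite_nu: "finite_measure \<nu>"
    and null_nu: "emeasure \<nu> (- K) = 0" and bounded_K: "bounded K" and borel_K: "K \<in> sets borel"
    and finite_potential: "finite_log_potential_at \<nu> \<xi>"
    and continuous_log_potential: "continuous_on UNIV (log_potential \<nu>)"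
begin

sublocale finite_measure \<nu> by (rule finite_nu)

declare sets_nu [measurable_cong, simp]

lemma space_nu [simp]: "space \<nu> = UNIV"
  using sets_eq_imp_space_eq[OF sets_nu] by simp

lemma integrable_ln: "integrable \<nu> (\<lambda>c. ln (cmod (\<xi> - c)))"
  using finite_potential by (simp add: finite_log_potential_at_def)

lemma AE_neq: "AE c in \<nu>. c \<noteq> \<xi>"
proof (rule AE_I)
  show "emeasure \<nu> {\<xi>} = 0" using finite_potential by (simp add: finite_log_potential_at_def)
qed auto

lemma AE_in_K: "AE c in \<nu>. c \<in> K"
  by (rule AE_I[where N = "- K"]) (use null_nu borel_K in auto)

lemma integrable_ln_max:
  assumes "0 < \<epsilon>" shows "integrable \<nu> (\<lambda>c. ln (max \<epsilon> (cmod (\<xi> - c))))"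
proof (rule Bochner_Integration.integrable_bound)
  show "integrable \<nu> (\<lambda>c. \<bar>ln \<epsilon>\<bar> + \<bar>ln (cmod (\<xi> - c))\<bar>)"
    by (intro Bochner_Integration.integrable_add integrable_const integrable_abs integrable_ln)
qed (auto simp: max_def)

text \<open>The \<nu>-integral of the positive part of \<open>ln (\<epsilon> / |\<xi> - c|)\<close>,
  kept as a real difference of potentials so that its continuity in \<xi> can be read off.\<close>

definition trunc_defect :: "real \<Rightarrow> complex \<Rightarrow> real" where
  "trunc_defect \<epsilon> \<xi> = (LINT c|\<nu>. ln (max \<epsilon> (cmod (\<xi> - c)))) - log_potential \<nu> \<xi>"

lemma nn_integral_log_deficit:
  assumes \<epsilon>: "0 < \<epsilon>"
  shows "(\<integral>\<^sup>+c. log_deficit \<epsilon> (cmod (\<xi> - c)) \<partial>\<nu>) = ennreal (trunc_defect \<epsilon> \<xi>)"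
proof -
  have "(\<integral>\<^sup>+c. log_deficit \<epsilon> (cmod (\<xi> - c)) \<partial>\<nu>) =
      (\<integral>\<^sup>+c. ennreal (ln (max \<epsilon> (cmod (\<xi> - c))) - ln (cmod (\<xi> - c))) \<partial>\<nu>)"
  proof (rule nn_integral_cong_AE)
    show "AE c in \<nu>. log_deficit \<epsilon> (cmod (\<xi> - c)) =
        ennreal (ln (max \<epsilon> (cmod (\<xi> - c))) - ln (cmod (\<xi> - c)))"
      using AE_neq[of \<xi>]
      by eventually_elim (use \<epsilon> in \<open>auto simp: log_deficit_def max_def ennreal_neg\<close>)
  qed
  also have "\<dots> = ennreal (LINT c|\<nu>. ln (max \<epsilon> (cmod (\<xi> - c))) - ln (cmod (\<xi> - c)))"
  proof (rule nn_integral_eq_integral)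
    show "AE c in \<nu>. 0 \<le> ln (max \<epsilon> (cmod (\<xi> - c))) - ln (cmod (\<xi> - c))"
      using AE_neq[of \<xi>] by eventually_elim (use \<epsilon> in \<open>auto simp: max_def\<close>)
  qed (intro Bochner_Integration.integrable_diff integrable_ln integrable_ln_max \<epsilon>)
  also have "\<dots> = ennreal (trunc_defect \<epsilon> \<xi>)"
    by (simp add: trunc_defect_def log_potential_def Bochner_Integration.integral_diff
        integrable_ln integrable_ln_max \<epsilon>)
  finally show ?thesis .
qed

text \<open>The truncated potential is Lipschitz because its kernel is; continuity of the full
  potential enters through the subtracted term.\<close>

lemma continuous_trunc_defect:
  assumes \<epsilon>: "0 < \<epsilon>" shows "continuous_on UNIV (trunc_defect \<epsilon>)"
proof -
  have "lipschitz_on (measure \<nu> UNIV / \<epsilon>) UNIV (\<lambda>\<xi>. LINT c|\<nu>. ln (max \<epsilon> (cmod (\<xi> - c))))"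
  proof (rule lipschitz_onI)
    fix x y :: complex
    have "\<bar>(LINT c|\<nu>. ln (max \<epsilon> (cmod (x - c)))) - (LINT c|\<nu>. ln (max \<epsilon> (cmod (y - c))))\<bar>
        = \<bar>LINT c|\<nu>. ln (max \<epsilon> (cmod (x - c))) - ln (max \<epsilon> (cmod (y - c)))\<bar>"
      by (simp add: Bochner_Integration.integral_diff integrable_ln_max \<epsilon>)
    also have "\<dots> \<le> (LINT c|\<nu>. \<bar>ln (max \<epsilon> (cmod (x - c))) - ln (max \<epsilon> (cmod (y - c)))\<bar>)"
      by (rule integral_abs_bound)
    also have "\<dots> \<le> (LINT c|\<nu>. dist x y / \<epsilon>)"
    proof (rule integral_mono)
      fix c
      have "\<bar>cmod (x - c) - cmod (y - c)\<bar> \<le> dist x y"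
        using norm_triangle_ineq3[of "x - c" "y - c"] by (simp add: dist_norm)
      then show "\<bar>ln (max \<epsilon> (cmod (x - c))) - ln (max \<epsilon> (cmod (y - c)))\<bar> \<le> dist x y / \<epsilon>"
        using abs_ln_max_diff_le[OF \<epsilon>, of "cmod (x - c)" "cmod (y - c)"] \<epsilon>
        by (meson divide_right_mono less_imp_le order_trans)
    qed (auto intro!: integrable_abs Bochner_Integration.integrable_diff integrable_ln_max \<epsilon>)
    finally show "dist (LINT c|\<nu>. ln (max \<epsilon> (cmod (x - c)))) (LINT c|\<nu>. ln (max \<epsilon> (cmod (y - c))))
        \<le> measure \<nu> UNIV / \<epsilon> * dist x y"
      by (simp add: dist_real_def mult.commute)
  qed (use \<epsilon> in simp)
  then show ?thesis
    unfolding trunc_defect_def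
    by (intro continuous_on_diff continuous_log_potential lipschitz_on_continuous_on)
qed

lemma trunc_defect_tendsto_0: "(\<lambda>n. trunc_defect (1 / real (Suc n)) \<xi>) \<longlonglongrightarrow> 0"
proof -
  have "(\<lambda>n. LINT c|\<nu>. ln (max (1 / real (Suc n)) (cmod (\<xi> - c))) - ln (cmod (\<xi> - c)))
      \<longlonglongrightarrow> (LINT c|\<nu>. 0)"
  proof (rule integral_dominated_convergence)
    show "integrable \<nu> (\<lambda>c. \<bar>ln (cmod (\<xi> - c))\<bar>)" by (intro integrable_abs integrable_ln)
    show "AE c in \<nu>. (\<lambda>n. ln (max (1 / real (Suc n)) (cmod (\<xi> - c))) - ln (cmod (\<xi> - c))) \<longlonglongrightarrow> 0"
      using AE_neq[of \<xi>]
    proof eventually_elim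
      case (elim c)
      have "(\<lambda>n. 1 / real (Suc n)) \<longlonglongrightarrow> 0" by (rule LIMSEQ_Suc[OF lim_1_over_n])
      then have "\<forall>\<^sub>F n in sequentially. 1 / real (Suc n) < cmod (\<xi> - c)"
        by (rule order_tendstoD) (use elim in auto)
      then have "\<forall>\<^sub>F n in sequentially. ln (max (1 / real (Suc n)) (cmod (\<xi> - c))) - ln (cmod (\<xi> - c)) = 0"
        by eventually_elim (simp add: max_def)
      then show ?case by (rule tendsto_eventually)
    qed
    \<comment> \<open>The truncation levels are at most 1, so wherever the truncated logarithm
      differs from \<open>ln |\<xi> - c|\<close> it lies between that value and 0.\<close>
    show "AE c in \<nu>. norm (ln (max (1 / real (Suc n)) (cmod (\<xi> - c))) - ln (cmod (\<xi> - c)))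
        \<le> \<bar>ln (cmod (\<xi> - c))\<bar>" for n
      using AE_neq[of \<xi>]
    proof eventually_elim
      case (elim c)
      have "ln (1 / real (Suc n)) \<le> 0" by (simp add: ln_div)
      moreover have "ln (cmod (\<xi> - c)) \<le> ln (1 / real (Suc n))" if "cmod (\<xi> - c) \<le> 1 / real (Suc n)"
        using that elim by (subst ln_le_cancel_iff) auto
      ultimately have "\<bar>ln (1 / real (Suc n)) - ln (cmod (\<xi> - c))\<bar> \<le> \<bar>ln (cmod (\<xi> - c))\<bar>"
        if "cmod (\<xi> - c) \<le> 1 / real (Suc n)"
        using that by linarith
      then show ?case by (cases "cmod (\<xi> - c) \<le> 1 / real (Suc n)") (simp_all add: max_def del: of_nat_Suc)
    qed
  qed auto
  then show ?thesis
    by (simp add: trunc_defect_def log_potential_def Bochner_Integration.integral_diff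
        integrable_ln integrable_ln_max)
qed

text \<open>The truncated potentials decrease to the continuous potential, so by Dini's argument they do
  so uniformly on compact sets; away from \<open>K\<close> they agree with it.\<close>

lemma uniform_log_deficit:
  assumes e: "0 < e"
  obtains \<epsilon> where "0 < \<epsilon>" "\<And>\<xi>. (\<integral>\<^sup>+c. log_deficit \<epsilon> (cmod (\<xi> - c)) \<partial>\<nu>) \<le> ennreal e"
proof -
  obtain R where R: "\<And>c. c \<in> K \<Longrightarrow> cmod c \<le> R" using bounded_K unfolding bounded_iff by blast
  define U where "U n = {\<xi>. trunc_defect (1 / real (Suc n)) \<xi> < e}" for n :: nat
  have "open (U n)" for n
    unfolding U_def by (intro open_Collect_less continuous_trunc_defect continuous_on_const) simp
  moreover have "cball 0 (R + 1) \<subseteq> (\<Union>n. U n)"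
  proof
    fix \<xi>
    have "\<forall>\<^sub>F n in sequentially. trunc_defect (1 / real (Suc n)) \<xi> < e"
      using trunc_defect_tendsto_0 e by (rule order_tendstoD)
    then obtain n where "trunc_defect (1 / real (Suc n)) \<xi> < e"
      unfolding eventually_sequentially by blast
    then show "\<xi> \<in> (\<Union>n. U n)" unfolding U_def by blast
  qed
  ultimately obtain N where "N \<subseteq> UNIV" and N: "finite N" "cball 0 (R + 1) \<subseteq> (\<Union>n\<in>N. U n)"
    by (rule compactE_image[OF compact_cball])
  \<comment> \<open>\<open>insert 0\<close> keeps \<open>Max\<close> meaningful when the cover is
    empty.\<close>
  define n where "n = Max (insert 0 N)"
  show ?thesis
  proof (rule that[of "1 / real (Suc n)"])
    fix \<xi>
    show "(\<integral>\<^sup>+c. log_deficit (1 / real (Suc n)) (cmod (\<xi> - c)) \<partial>\<nu>) \<le> ennreal e"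
    proof (cases "cmod \<xi> \<le> R + 1")
      case True
      then have "\<xi> \<in> (\<Union>n\<in>N. U n)" using N(2) by (meson mem_cball_0 subsetD)
      then obtain k where k: "k \<in> N" "\<xi> \<in> U k" by blast
      then have "k \<le> n" using N(1) by (simp add: n_def)
      then have "(\<integral>\<^sup>+c. log_deficit (1 / real (Suc n)) (cmod (\<xi> - c)) \<partial>\<nu>)
          \<le> (\<integral>\<^sup>+c. log_deficit (1 / real (Suc k)) (cmod (\<xi> - c)) \<partial>\<nu>)"
        by (intro nn_integral_mono log_deficit_mono_left divide_left_mono) simp_all
      also have "\<dots> = ennreal (trunc_defect (1 / real (Suc k)) \<xi>)"
        by (rule nn_integral_log_deficit) simp
      also have "\<dots> \<le> ennreal e" using k(2) by (intro ennreal_leI) (simp add: U_def)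
      finally show ?thesis .
    next
      case False
      have "(\<integral>\<^sup>+c. log_deficit (1 / real (Suc n)) (cmod (\<xi> - c)) \<partial>\<nu>) = (\<integral>\<^sup>+c. 0 \<partial>\<nu>)"
      proof (rule nn_integral_cong_AE)
        show "AE c in \<nu>. log_deficit (1 / real (Suc n)) (cmod (\<xi> - c)) = 0"
          using AE_in_K
        proof eventually_elim
          case (elim c)
          \<comment> \<open>The margin 1 in \<open>R + 1\<close> is the largest truncation level, so
            the truncation does not reach points of \<open>K\<close>.\<close>
          have "cmod \<xi> - cmod c \<le> cmod (\<xi> - c)" by (rule norm_triangle_ineq2)
          then have "1 \<le> cmod (\<xi> - c)" using False R[OF elim] by linarith
          then have "cmod (\<xi> - c) \<noteq> 0" "0 \<le> ln (cmod (\<xi> - c))" "ln (1 / real (Suc n)) \<le> 0"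
            by (linarith, simp_all add: ln_div)
          moreover from this have "ln (1 / real (Suc n)) - ln (cmod (\<xi> - c)) \<le> 0" by linarith
          ultimately show ?case by (simp only: log_deficit_def if_False ennreal_neg)
        qed
      qed
      then show ?thesis by simp
    qed
  qed simp
qed

text \<open>The deficit of a product is at most the sum of the deficits, so each of the
  \<open>n\<close> eigenvalues gets the threshold \<epsilon> and the share \<open>e / n\<close>, and
  \<delta> is \<open>\<epsilon> ^ n\<close>. The bound for one point is uniform in its position,
  hence the bound for the determinant is uniform in \<open>A\<close>.\<close>

lemma uniform_log_deficit_det:
  assumes e: "0 < e"
  obtains \<delta> where "0 < \<delta>"
    "\<And>A :: complex ^ 'n ^ 'n. (\<integral>\<^sup>+c. log_deficit \<delta> (cmod (det (A - mat c))) \<partial>\<nu>) \<le> ennreal e"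
proof -
  let ?n = "CARD('n)"
  have "0 < e / ?n" using e by simp
  then obtain \<epsilon> where \<epsilon>: "0 < \<epsilon>" "\<And>\<xi>. (\<integral>\<^sup>+c. log_deficit \<epsilon> (cmod (\<xi> - c)) \<partial>\<nu>) \<le> ennreal (e / ?n)"
    using uniform_log_deficit by blast
  have M: "(\<integral>\<^sup>+c. log_deficit (\<epsilon> ^ size M) (cmod (\<Prod>x\<in>#M. x - c)) \<partial>\<nu>) \<le> of_nat (size M) * ennreal (e / ?n)"
    for M :: "complex multiset"
  proof (induction M)
    case empty
    then show ?case by (simp add: log_deficit_def)
  next
    case (add x M)
    have meas: "(\<lambda>c. \<Prod>x\<in>#M. x - c) \<in> borel_measurable borel" for M :: "complex multiset"
      by (induction M) auto
    have "(\<integral>\<^sup>+c. log_deficit (\<epsilon> ^ size (add_mset x M)) (cmod (\<Prod>x\<in>#add_mset x M. x - c)) \<partial>\<nu>)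
      \<le> (\<integral>\<^sup>+c. log_deficit \<epsilon> (cmod (x - c)) + log_deficit (\<epsilon> ^ size M) (cmod (\<Prod>x\<in>#M. x - c)) \<partial>\<nu>)"
      using \<epsilon>(1) by (intro nn_integral_mono) (simp add: norm_mult log_deficit_mult_le)
    also have "\<dots> = (\<integral>\<^sup>+c. log_deficit \<epsilon> (cmod (x - c)) \<partial>\<nu>) +
        (\<integral>\<^sup>+c. log_deficit (\<epsilon> ^ size M) (cmod (\<Prod>x\<in>#M. x - c)) \<partial>\<nu>)"
      using meas[of M] by (intro nn_integral_add) measurable
    also have "\<dots> \<le> ennreal (e / ?n) + of_nat (size M) * ennreal (e / ?n)"
      by (intro add_mono \<epsilon> add)
    finally show ?case by (simp add: distrib_right)
  qed
  show ?thesis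
  proof (rule that[of "\<epsilon> ^ ?n"])
    fix A :: "complex ^ 'n ^ 'n"
    obtain M where "size M = ?n" "\<And>c. det (A - mat c) = (\<Prod>x\<in>#M. x - c)"
      using det_shift_factorization[of A] by blast
    then have "(\<integral>\<^sup>+c. log_deficit (\<epsilon> ^ ?n) (cmod (det (A - mat c))) \<partial>\<nu>) \<le> of_nat ?n * ennreal (e / ?n)"
      using M[of M] by simp
    also have "\<dots> = ennreal e"
      using e by (simp add: ennreal_of_nat_eq_real_of_nat flip: ennreal_mult)
    finally show "(\<integral>\<^sup>+c. log_deficit (\<epsilon> ^ ?n) (cmod (det (A - mat c))) \<partial>\<nu>) \<le> ennreal e" .
  qed (use \<epsilon> in simp)
qed

end

section \<open>Outer functions\<close>

lemma id_measurable_circle_measure [measurable]: "(\<lambda>t. t) \<in> borel_measurable circle_measure"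
  by (intro borel_measurable_circle_measure continuous_on_id)

lemma sigma_finite_circle_measure: "sigma_finite_measure circle_measure"
  using finite_measure_circle_measure by (simp add: finite_measure_def)

lemma ennreal_integral_le_nn_integral:
  fixes f :: "'a \<Rightarrow> real"
  assumes "integrable M f"
  shows "ennreal (LINT x|M. f x) \<le> (\<integral>\<^sup>+x. ennreal (f x) \<partial>M)"
proof -
  have "(LINT x|M. f x) \<le> (LINT x|M. max 0 (f x))"
    using assms by (intro integral_mono) auto
  then have "ennreal (LINT x|M. f x) \<le> ennreal (LINT x|M. max 0 (f x))" by (rule ennreal_leI)
  also have "\<dots> = (\<integral>\<^sup>+x. ennreal (max 0 (f x)) \<partial>M)"
    using assms by (intro nn_integral_eq_integral[symmetric]) auto
  also have "\<dots> = (\<integral>\<^sup>+x. ennreal (f x) \<partial>M)"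
    by (intro nn_integral_cong) (simp add: max_def ennreal_neg)
  finally show ?thesis .
qed

section \<open>The Poisson kernel\<close>

definition poisson_kernel :: "complex \<Rightarrow> complex \<Rightarrow> real" where
  "poisson_kernel z t = Re ((t + z) / (t - z))"

lemma poisson_kernel_nonneg:
  assumes "cmod z < 1" "cmod t = 1" shows "0 \<le> poisson_kernel z t"
proof -
  have "poisson_kernel z t = Re ((t + z) * cnj (t - z)) / (cmod (t - z))\<^sup>2"
    unfolding poisson_kernel_def complex_div_cnj[of "t + z"] by (simp flip: of_real_power)
  also have "Re ((t + z) * cnj (t - z)) = (cmod t)\<^sup>2 - (cmod z)\<^sup>2"
    unfolding cmod_power2 by (simp add: power2_eq_square algebra_simps)
  finally show ?thesis using assms by (simp add: power_le_one)
qed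

text \<open>In the variable \<open>t\<close> the quotient has a pole at \<open>z\<close> inside the
  disc. On the circle, however, \<open>cnj t = 1 / t\<close>, so its real part is that of
  \<open>(1 + cnj z * t) / (1 - cnj z * t)\<close>, which is holomorphic on a disc of radius above 1
  and has value 1 at 0.\<close>

lemma integral_poisson_kernel_boundary:
  assumes z: "cmod z < 1"
  shows "integrable circle_measure (\<lambda>t. (t + z) / (t - z))"
    and "(LINT t|circle_measure. poisson_kernel z t) = 1"
proof -
  have ne: "t \<noteq> z" if "cmod t = 1" for t using that z by auto
  have cont: "continuous_on unit_circle (\<lambda>t. (t + z) / (t - z))"
    by (intro continuous_intros) (use ne in auto)
  then show int: "integrable circle_measure (\<lambda>t. (t + z) / (t - z))"
    by (rule integrable_circle_measure)
  obtain R where R: "1 < R" "cmod z * R < 1"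
  proof (cases "z = 0")
    case False
    then have "1 < 1 / cmod z" using z by simp
    then obtain R where "1 < R" "R < 1 / cmod z" using dense by blast
    then show ?thesis using False by (intro that[of R]) (auto simp: field_simps)
  qed (use that[of 2] in auto)
  let ?g = "\<lambda>t. (1 + cnj z * t) / (1 - cnj z * t)"
  have "1 - cnj z * t \<noteq> 0" if "cmod t < R" for t
  proof
    assume "1 - cnj z * t = 0"
    then have "cmod (cnj z * t) = 1" by simp
    moreover have "cmod (cnj z * t) \<le> cmod z * R"
      using that by (simp add: norm_mult mult_left_mono)
    ultimately show False using R by simp
  qed
  then have hol: "?g holomorphic_on ball 0 R" by (intro holomorphic_intros) auto
  have eq: "poisson_kernel z t = Re (?g (of_real 1 * t))" if "cmod t = 1" for t
  proof -
    have tt: "cnj t * t = 1" using complex_norm_square[of t] that by (simp add: mult.commute)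
    have "(t + z) / (t - z) = (cnj t * (t + z)) / (cnj t * (t - z))"
      using that by auto
    also have "\<dots> = (1 + cnj t * z) / (1 - cnj t * z)"
      by (simp add: distrib_left right_diff_distrib tt)
    also have "\<dots> = cnj (?g t)" by (simp add: mult.commute)
    finally show ?thesis by (simp add: poisson_kernel_def del: complex_cnj_divide)
  qed
  have "(LINT t|circle_measure. poisson_kernel z t) = (LINT t|circle_measure. Re (?g (of_real 1 * t)))"
    by (intro Bochner_Integration.integral_cong refl eq) simp
  also have "\<dots> = Re (LINT t|circle_measure. ?g (of_real 1 * t))"
    using R by (intro integral_Re integrable_circle_measure
        continuous_on_circle_dilation[OF holomorphic_on_imp_continuous_on[OF hol]]) auto
  also have "\<dots> = Re (?g 0)"
    using R by (subst circle_mean_value[OF hol]) auto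
  finally show "(LINT t|circle_measure. poisson_kernel z t) = 1" by simp
qed

lemma integrable_poisson_kernel_boundary:
  "cmod z < 1 \<Longrightarrow> integrable circle_measure (poisson_kernel z)"
  unfolding poisson_kernel_def by (intro integrable_Re integral_poisson_kernel_boundary)

text \<open>Here the boundary point is fixed and the mean runs over the interior circle:
  \<open>(s + z) / (s - z)\<close> is holomorphic in \<open>z\<close> with value 1 at 0. This is the
  inner integral after exchanging the integrations.\<close>

lemma nn_integral_poisson_kernel_interior:
  assumes s: "cmod s = 1" and r: "0 \<le> r" "r < 1"
  shows "(\<integral>\<^sup>+t. ennreal (poisson_kernel (of_real r * t) s) \<partial>circle_measure) = 1"
proof -
  let ?g = "\<lambda>z. (s + z) / (s - z)"
  have hol: "?g holomorphic_on ball 0 1"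
    by (intro holomorphic_intros) (use s in auto)
  have int: "integrable circle_measure (\<lambda>t. ?g (of_real r * t))"
    by (intro integrable_circle_measure
        continuous_on_circle_dilation[OF holomorphic_on_imp_continuous_on[OF hol]] r)
  have "(\<integral>\<^sup>+t. ennreal (poisson_kernel (of_real r * t) s) \<partial>circle_measure) =
      ennreal (LINT t|circle_measure. poisson_kernel (of_real r * t) s)"
  proof (rule nn_integral_eq_integral)
    show "integrable circle_measure (\<lambda>t. poisson_kernel (of_real r * t) s)"
      unfolding poisson_kernel_def by (rule integrable_Re[OF int])
    show "AE t in circle_measure. 0 \<le> poisson_kernel (of_real r * t) s"
      using r s by (intro AE_I2 poisson_kernel_nonneg) (simp_all add: norm_mult)
  qed
  also have "(LINT t|circle_measure. poisson_kernel (of_real r * t) s) = Re (?g 0)"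
    unfolding poisson_kernel_def using circle_mean_value[OF hol r] int by (simp add: integral_Re)
  also have "Re (?g 0) = 1" using s by auto
  finally show ?thesis by simp
qed

text \<open>The positive parts of the harmonic functions \<open>ln \<bar>e (r t)\<bar> - M\<close> are dominated by the Poisson
  integral of the positive part of \<open>ln w - M\<close>, whose mass does not depend on \<open>r\<close>.\<close>

lemma nn_integral_ln_outer_le:
  assumes C: "cmod C = 1" and w: "integrable circle_measure u"
    and e: "\<And>z. z \<in> unit_disc \<Longrightarrow> e z = C * exp (LINT t|circle_measure. (t + z) / (t - z) * of_real (u t))"
    and r: "0 \<le> r" "r < 1"
  shows "(\<integral>\<^sup>+t. ennreal (ln (cmod (e (of_real r * t))) - M) \<partial>circle_measure)
    \<le> (\<integral>\<^sup>+s. ennreal (u s - M) \<partial>circle_measure)"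
proof -
  interpret finite_measure circle_measure by (rule finite_measure_circle_measure)
  interpret P: pair_sigma_finite circle_measure circle_measure
    by (intro pair_sigma_finite.intro sigma_finite_circle_measure)
  have u [measurable]: "u \<in> borel_measurable circle_measure" using w by simp
  \<comment> \<open>The kernel has mass 1, so \<open>M\<close> can be subtracted under the integral;
    \<open>ennreal\<close> takes positive parts, which turns the equality into the required upper
    bound.\<close>
  have pw: "ennreal (ln (cmod (e z)) - M) \<le> (\<integral>\<^sup>+s. ennreal (poisson_kernel z s) * ennreal (u s - M) \<partial>circle_measure)"
    if z: "cmod z < 1" for z
  proof -
    have ne: "s \<noteq> z" if "cmod s = 1" for s using that z by auto
    obtain B where B: "\<And>s. cmod s = 1 \<Longrightarrow> cmod ((s + z) / (s - z)) \<le> B"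
    proof -
      have "continuous_on unit_circle (\<lambda>t. (t + z) / (t - z))"
        by (intro continuous_intros) (use ne in auto)
      then have "bounded ((\<lambda>t. (t + z) / (t - z)) ` unit_circle)"
        by (intro compact_imp_bounded compact_continuous_image) simp_all
      then obtain B where "\<forall>x\<in>(\<lambda>t. (t + z) / (t - z)) ` unit_circle. norm x \<le> B"
        unfolding bounded_iff by blast
      then show ?thesis by (intro that[of B]) auto
    qed
    have int: "integrable circle_measure (\<lambda>t. (t + z) / (t - z) * of_real (u t))"
    proof (rule Bochner_Integration.integrable_bound)
      show "integrable circle_measure (\<lambda>t. B * u t)" using w by simp
      show "AE t in circle_measure. norm ((t + z) / (t - z) * of_real (u t)) \<le> norm (B * u t)"
      proof (rule AE_I2)
        fix t assume "t \<in> space circle_measure"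
        then have t: "cmod ((t + z) / (t - z)) \<le> B" by (intro B) simp
        then have "0 \<le> B" using norm_ge_zero order_trans by blast
        then show "norm ((t + z) / (t - z) * of_real (u t)) \<le> norm (B * u t)"
          using t by (simp only: norm_mult norm_of_real real_norm_def abs_mult abs_of_nonneg mult_right_mono abs_ge_zero)
      qed
    qed measurable
    have eqP: "Re ((t + z) / (t - z) * of_real (u t)) = poisson_kernel z t * u t" for t
      unfolding poisson_kernel_def by (simp only: times_complex.sel Re_complex_of_real Im_complex_of_real mult_zero_right diff_zero)
    have intP: "integrable circle_measure (\<lambda>t. poisson_kernel z t * u t)"
      using integrable_Re[OF int] unfolding eqP .
    have "ln (cmod (e z)) = Re (LINT t|circle_measure. (t + z) / (t - z) * of_real (u t))"
      using e[of z] z C by (simp add: norm_mult)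
    also have "\<dots> = (LINT t|circle_measure. poisson_kernel z t * u t)"
      unfolding integral_Re[OF int, symmetric] eqP ..
    finally have "ln (cmod (e z)) - M = (LINT t|circle_measure. poisson_kernel z t * u t) -
        M * (LINT t|circle_measure. poisson_kernel z t)"
      by (simp add: integral_poisson_kernel_boundary(2)[OF z])
    also have "\<dots> = (LINT t|circle_measure. poisson_kernel z t * u t - M * poisson_kernel z t)"
      using integrable_poisson_kernel_boundary[OF z] intP
      by (subst Bochner_Integration.integral_diff) simp_all
    also have "\<dots> = (LINT t|circle_measure. poisson_kernel z t * (u t - M))"
      by (simp add: algebra_simps)
    finally have "ennreal (ln (cmod (e z)) - M) = ennreal (LINT t|circle_measure. poisson_kernel z t * (u t - M))"
      by simp
    also have "\<dots> \<le> (\<integral>\<^sup>+s. ennreal (poisson_kernel z s * (u s - M)) \<partial>circle_measure)"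
    proof (rule ennreal_integral_le_nn_integral)
      have "integrable circle_measure (\<lambda>t. poisson_kernel z t * u t - M * poisson_kernel z t)"
        using integrable_poisson_kernel_boundary[OF z] intP by simp
      then show "integrable circle_measure (\<lambda>s. poisson_kernel z s * (u s - M))"
        by (simp add: algebra_simps)
    qed
    also have "\<dots> = (\<integral>\<^sup>+s. ennreal (poisson_kernel z s) * ennreal (u s - M) \<partial>circle_measure)"
      using poisson_kernel_nonneg[OF z] by (intro nn_integral_cong) (simp add: ennreal_mult')
    finally show ?thesis .
  qed
  have "(\<integral>\<^sup>+t. ennreal (ln (cmod (e (of_real r * t))) - M) \<partial>circle_measure)
      \<le> (\<integral>\<^sup>+t. (\<integral>\<^sup>+s. ennreal (poisson_kernel (of_real r * t) s) * ennreal (u s - M) \<partial>circle_measure) \<partial>circle_measure)"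
    using r by (intro nn_integral_mono pw) (simp add: norm_mult)
  also have "\<dots> = (\<integral>\<^sup>+s. (\<integral>\<^sup>+t. ennreal (poisson_kernel (of_real r * t) s) * ennreal (u s - M) \<partial>circle_measure) \<partial>circle_measure)"
    unfolding poisson_kernel_def by (rule P.Fubini') measurable
  also have "\<dots> = (\<integral>\<^sup>+s. (\<integral>\<^sup>+t. ennreal (poisson_kernel (of_real r * t) s) \<partial>circle_measure) * ennreal (u s - M) \<partial>circle_measure)"
    unfolding poisson_kernel_def by (intro nn_integral_cong nn_integral_multc) measurable
  also have "\<dots> = (\<integral>\<^sup>+s. ennreal (u s - M) \<partial>circle_measure)"
    by (intro nn_integral_cong) (simp add: nn_integral_poisson_kernel_interior r)
  finally show ?thesis .
qed

section \<open>Almost every shift\<close>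

text \<open>Tonelli's theorem exchanges the circle mean with the \<nu>-integral, which is bounded
  for each matrix \<open>F (\<rho> k * t)\<close> separately; hence the bound is uniform in
  \<open>k\<close>. Fatou's lemma passes it to the lower limit, and this accounts for
  \<open>\<exists>\<^sub>F\<close> in the conclusion.\<close>

lemma (in continuous_potential) AE_small_log_deficit:
  fixes F :: "complex \<Rightarrow> complex ^ 'n ^ 'n"
  assumes F: "matrix_holomorphic_on F unit_disc" and \<rho>: "\<And>k. 0 \<le> \<rho> k" "\<And>k. \<rho> k < (1 :: real)"
  shows "AE c in \<nu>. \<forall>e>0. \<exists>\<delta>>0. \<exists>\<^sub>F k in sequentially.
    (\<integral>\<^sup>+t. log_deficit \<delta> (cmod (det (F (of_real (\<rho> k) * t) - mat c))) \<partial>circle_measure) < ennreal e"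
proof -
  interpret C: finite_measure circle_measure by (rule finite_measure_circle_measure)
  interpret P: pair_sigma_finite \<nu> circle_measure
    by (intro pair_sigma_finite.intro sigma_finite_circle_measure sigma_finite_measure_axioms)
  define J where "J \<delta> k c =
    (\<integral>\<^sup>+t. log_deficit \<delta> (cmod (det (F (of_real (\<rho> k) * t) - mat c))) \<partial>circle_measure)" for \<delta> k c
  have [measurable]: "(\<lambda>t. F (of_real (\<rho> k) * t) $ i $ j) \<in> borel_measurable circle_measure" for k i j
    using F by (intro borel_measurable_circle_measure continuous_on_circle_dilation[where R = 1]
        holomorphic_on_imp_continuous_on \<rho>) (simp add: matrix_holomorphic_on_def)
  have [measurable]: "(\<lambda>c. mat c $ i $ j :: complex) \<in> borel_measurable \<nu>" for i j :: 'n
  proof (cases "i = j")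
    case True
    then have "(\<lambda>c. mat c $ i $ j :: complex) = (\<lambda>c. c)" by (simp add: mat_def)
    then show ?thesis using measurable_ident_sets[OF sets_nu] by simp
  next
    case False
    then have "(\<lambda>c. mat c $ i $ j :: complex) = (\<lambda>c. 0)" by (simp add: mat_def)
    then show ?thesis by simp
  qed
  have meas [measurable]: "(\<lambda>(c, t). log_deficit \<delta> (cmod (det (F (of_real (\<rho> k) * t) - mat c))))
      \<in> borel_measurable (\<nu> \<Otimes>\<^sub>M circle_measure)" for \<delta> k
    unfolding det_def vector_minus_component by measurable
  have J_meas [measurable]: "J \<delta> k \<in> borel_measurable \<nu>" for \<delta> k
    unfolding J_def by measurable
  have "\<exists>\<delta>>0. \<forall>A :: complex ^ 'n ^ 'n.
      (\<integral>\<^sup>+c. log_deficit \<delta> (cmod (det (A - mat c))) \<partial>\<nu>) \<le> ennreal (1 / real (Suc j))" for j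
    using uniform_log_deficit_det[of "1 / real (Suc j)"] by (metis divide_pos_pos of_nat_0_less_iff zero_less_Suc zero_less_one)
  then obtain \<delta> where \<delta>: "\<And>j. 0 < \<delta> j"
    "\<And>j A. (\<integral>\<^sup>+c. log_deficit (\<delta> j) (cmod (det ((A :: complex ^ 'n ^ 'n) - mat c))) \<partial>\<nu>) \<le> ennreal (1 / real (Suc j))"
    by metis
  have J_int: "(\<integral>\<^sup>+c. J (\<delta> j) k c \<partial>\<nu>) \<le> ennreal (1 / real (Suc j))" for j k
  proof -
    have "(\<integral>\<^sup>+c. J (\<delta> j) k c \<partial>\<nu>) = (\<integral>\<^sup>+t. (\<integral>\<^sup>+c. log_deficit (\<delta> j)
        (cmod (det (F (of_real (\<rho> k) * t) - mat c))) \<partial>\<nu>) \<partial>circle_measure)"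
      unfolding J_def by (rule P.Fubini'[OF meas, symmetric])
    also have "\<dots> \<le> (\<integral>\<^sup>+t. ennreal (1 / real (Suc j)) \<partial>circle_measure)"
      by (intro nn_integral_mono \<delta>)
    also have "\<dots> = ennreal (1 / real (Suc j))" by (simp add: emeasure_circle_measure)
    finally show ?thesis .
  qed
  \<comment> \<open>Lower limit in \<open>k\<close> inside, infimum over the thresholds outside: the
    integral of \<open>D\<close> is at most every \<open>1 / (j + 1)\<close>, hence zero.\<close>
  define D where "D c = (INF j. liminf (\<lambda>k. J (\<delta> j) k c))" for c
  have D_meas [measurable]: "D \<in> borel_measurable \<nu>" unfolding D_def by measurable
  have D_int: "(\<integral>\<^sup>+c. D c \<partial>\<nu>) \<le> ennreal (1 / real (Suc j))" for j
  proof -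
    have "(\<integral>\<^sup>+c. D c \<partial>\<nu>) \<le> (\<integral>\<^sup>+c. liminf (\<lambda>k. J (\<delta> j) k c) \<partial>\<nu>)"
      unfolding D_def by (intro nn_integral_mono INF_lower UNIV_I)
    also have "\<dots> \<le> liminf (\<lambda>k. \<integral>\<^sup>+c. J (\<delta> j) k c \<partial>\<nu>)"
      by (rule nn_integral_liminf) measurable
    also have "\<dots> \<le> liminf (\<lambda>k::nat. ennreal (1 / real (Suc j)))"
      by (intro Liminf_mono always_eventually allI J_int)
    also have "\<dots> = ennreal (1 / real (Suc j))" by (simp add: Liminf_const)
    finally show ?thesis .
  qed
  have "(\<lambda>j. ennreal (1 / real (Suc j))) \<longlonglongrightarrow> ennreal 0"
    by (intro tendsto_ennrealI LIMSEQ_Suc[OF lim_1_over_n])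
  then have "(\<integral>\<^sup>+c. D c \<partial>\<nu>) \<le> ennreal 0"
    by (rule tendsto_lowerbound) (intro always_eventually allI D_int, simp)
  then have "(\<integral>\<^sup>+c. D c \<partial>\<nu>) = 0" by simp
  then have "AE c in \<nu>. D c = 0" by (simp add: nn_integral_0_iff_AE)
  then show ?thesis
  proof eventually_elim
    case (elim c)
    show ?case
    proof (intro allI impI)
      fix e :: real assume "0 < e"
      then have "D c < ennreal e" using elim by simp
      then obtain j where j: "liminf (\<lambda>k. J (\<delta> j) k c) < ennreal e"
        unfolding D_def INF_less_iff by blast
      have "\<exists>\<^sub>F k in sequentially. J (\<delta> j) k c < ennreal e"
      proof (rule ccontr)
        assume "\<not> (\<exists>\<^sub>F k in sequentially. J (\<delta> j) k c < ennreal e)"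
        then have "\<forall>\<^sub>F k in sequentially. ennreal e \<le> J (\<delta> j) k c"
          by (simp add: not_frequently not_less)
        then have "ennreal e \<le> liminf (\<lambda>k. J (\<delta> j) k c)" by (rule Liminf_bounded)
        with j show False by simp
      qed
      then show "\<exists>\<delta>>0. \<exists>\<^sub>F k in sequentially.
          (\<integral>\<^sup>+t. log_deficit \<delta> (cmod (det (F (of_real (\<rho> k) * t) - mat c))) \<partial>circle_measure) < ennreal e"
        unfolding J_def using \<delta>(1) by blast
    qed
  qed
qed

text \<open>\<theta>, \<open>y\<close> and \<open>x\<close> stand for the moduli of
  \<open>det \<Theta>\<close>, \<open>det E\<close> and \<open>det (F - c)\<close>. Once
  \<open>ln (1 / \<theta>)\<close> exceeds \<open>M\<close> it equals \<open>M\<close> plus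
  \<open>ln (\<delta> / x)\<close> plus \<open>ln y - (ln \<delta> + M)\<close>, and
  \<open>ennreal\<close> bounds each summand by its positive part.\<close>

lemma log_deficit_inner_le:
  assumes \<theta>: "0 \<le> \<theta>" and y: "0 < y" and x: "x = \<theta> * y" and \<delta>: "0 < \<delta>" and M: "0 \<le> M"
  shows "log_deficit 1 \<theta> \<le> min (log_deficit 1 \<theta>) (ennreal M) + (log_deficit \<delta> x + ennreal (ln y - (ln \<delta> + M)))"
proof (cases "\<theta> = 0")
  case True
  then show ?thesis by (simp add: x log_deficit_def)
next
  case False
  then have \<theta>: "0 < \<theta>" using \<theta> by simp
  show ?thesis
  proof (cases "- ln \<theta> \<le> M")
    case True
    then have "log_deficit 1 \<theta> = min (log_deficit 1 \<theta>) (ennreal M)"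
      using False by (simp add: log_deficit_def min_def ennreal_leI)
    then show ?thesis by (metis add_increasing2 order_refl zero_le)
  next
    case nM: False
    have "log_deficit 1 \<theta> = ennreal (M + ((ln \<delta> - ln x) + (ln y - (ln \<delta> + M))))"
      using \<theta> y by (simp add: log_deficit_def x ln_mult)
    also have "\<dots> \<le> ennreal M + (ennreal (ln \<delta> - ln x) + ennreal (ln y - (ln \<delta> + M)))"
      by (rule order_trans[OF ennreal_add_le add_left_mono[OF ennreal_add_le]])
    also have "ennreal M = min (log_deficit 1 \<theta>) (ennreal M)"
      using nM \<theta> by (intro min_absorb2[symmetric]) (simp add: log_deficit_def ennreal_leI)
    also have "ennreal (ln \<delta> - ln x) = log_deficit \<delta> x"
      using \<theta> y by (simp add: log_deficit_def x)
    finally show ?thesis .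
  qed
qed

lemma inner_class_schur_class: "\<Theta> \<in> inner_class \<Longrightarrow> \<Theta> \<in> schur_class"
  by (simp add: inner_class_def schur_class_def opnorm_contractive)

text \<open>Radial limits of the determinant are unimodular almost everywhere, and the truncation at
  \<open>M\<close> supplies the dominating constant.\<close>

lemma inner_log_deficit_tendsto_0:
  assumes \<Theta>: "\<Theta> \<in> inner_class" and \<rho>: "\<rho> \<longlonglongrightarrow> 1" "\<And>k. 0 \<le> \<rho> k" "\<And>k. \<rho> k < (1 :: real)"
  shows "(\<lambda>k. \<integral>\<^sup>+t. min (log_deficit 1 (cmod (det (\<Theta> (of_real (\<rho> k) * t))))) (ennreal M) \<partial>circle_measure)
    \<longlonglongrightarrow> 0"
proof -
  have "filterlim \<rho> (at_left 1) sequentially"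
    unfolding filterlim_at using \<rho> by (auto intro!: always_eventually simp: less_imp_neq)
  have [measurable]: "(\<lambda>t. det (\<Theta> (of_real (\<rho> k) * t))) \<in> borel_measurable circle_measure" for k
    using \<Theta> by (intro borel_measurable_circle_measure \<rho>
        continuous_on_circle_dilation[where R = 1, OF holomorphic_on_imp_continuous_on[OF holomorphic_on_det]])
      (auto simp: inner_class_def)
  have "(\<lambda>k. \<integral>\<^sup>+t. min (log_deficit 1 (cmod (det (\<Theta> (of_real (\<rho> k) * t))))) (ennreal M) \<partial>circle_measure)
    \<longlonglongrightarrow> (\<integral>\<^sup>+t. 0 \<partial>circle_measure)"
  proof (rule nn_integral_dominated_convergence)
    show "(\<integral>\<^sup>+t. ennreal M \<partial>circle_measure) < \<infinity>"
      by (simp add: emeasure_circle_measure)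
    have "AE t in circle_measure. \<exists>U. unitary_matrix U \<and> ((\<lambda>r::real. \<Theta> (of_real r * t)) \<longlongrightarrow> U) (at_left 1)"
      using \<Theta> by (simp add: inner_class_def)
    then show "AE t in circle_measure. (\<lambda>k. min (log_deficit 1 (cmod (det (\<Theta> (of_real (\<rho> k) * t))))) (ennreal M)) \<longlonglongrightarrow> 0"
    proof eventually_elim
      case (elim t)
      then obtain U where U: "unitary_matrix U" "((\<lambda>r::real. \<Theta> (of_real r * t)) \<longlongrightarrow> U) (at_left 1)" by blast
      let ?x = "\<lambda>k. cmod (det (\<Theta> (of_real (\<rho> k) * t)))"
      have "?x \<longlonglongrightarrow> cmod (det U)"
        by (intro tendsto_norm tendsto_det filterlim_compose[OF U(2)]) fact
      then have x: "?x \<longlonglongrightarrow> 1" by (simp add: unitary_det[OF U(1)])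
      then have "(\<lambda>k. ennreal (ln 1 - ln (?x k))) \<longlonglongrightarrow> ennreal (ln 1 - ln 1)"
        by (intro tendsto_intros) auto
      then have lim: "(\<lambda>k. ennreal (ln 1 - ln (?x k))) \<longlonglongrightarrow> 0" by simp
      have "\<forall>\<^sub>F k in sequentially. 0 < ?x k" using x by (rule order_tendstoD) simp
      then have "\<forall>\<^sub>F k in sequentially. min (log_deficit 1 (?x k)) (ennreal M) \<le> ennreal (ln 1 - ln (?x k))"
        by eventually_elim (auto simp: log_deficit_def)
      then show ?case
        by (intro tendsto_sandwich[OF _ _ tendsto_const lim]) auto
    qed
  qed auto
  then show ?thesis by simp
qed

lemma nn_integral_excess_tendsto_0:
  assumes "finite_measure M" "integrable M (u :: 'a \<Rightarrow> real)"
  shows "(\<lambda>n. \<integral>\<^sup>+s. ennreal (u s - (c + real n)) \<partial>M) \<longlonglongrightarrow> 0"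
proof -
  interpret finite_measure M by fact
  have [measurable]: "u \<in> borel_measurable M" using assms by simp
  have int: "integrable M (\<lambda>s. u s - c)" using assms by simp
  have "(\<lambda>n. \<integral>\<^sup>+s. ennreal (u s - (c + real n)) \<partial>M) \<longlonglongrightarrow> (\<integral>\<^sup>+s. 0 \<partial>M)"
  proof (rule nn_integral_dominated_convergence)
    show "(\<integral>\<^sup>+s. ennreal (norm (u s - c)) \<partial>M) < \<infinity>"
      using int by (simp add: integrable_iff_bounded)
    show "AE s in M. ennreal (u s - (c + real n)) \<le> ennreal (norm (u s - c))" for n
      by (intro AE_I2 ennreal_leI) auto
    show "AE s in M. (\<lambda>n. ennreal (u s - (c + real n))) \<longlonglongrightarrow> 0"
    proof (intro AE_I2 tendsto_eventually)
      fix s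
      obtain N :: nat where "u s - c \<le> real N" using real_arch_simple by blast
      then have "u s - (c + real n) \<le> 0" if "N \<le> n" for n using that by simp
      then show "\<forall>\<^sub>F n in sequentially. ennreal (u s - (c + real n)) = 0"
        unfolding eventually_sequentially by (blast intro: ennreal_neg)
    qed
  qed auto
  then show ?thesis by simp
qed


text \<open>The order of choices matters: \<delta> comes from \<open>small\<close>, then
  \<open>n\<close> from integrability of \<open>ln w\<close>, and only then \<open>k\<close>. The
  outer term is below \<open>\<epsilon> / 3\<close> for every \<open>k\<close>, the truncated inner
  term for all large \<open>k\<close>, the term with \<open>f\<close> for infinitely many, so one
  \<open>k\<close> serves all three.\<close>

lemma inner_outer_small_log_deficit:
  assumes \<Theta>: "\<Theta> \<in> inner_class" and e: "scalar_outer e" "e holomorphic_on unit_disc"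
    and f: "\<And>z. z \<in> unit_disc \<Longrightarrow> f z = det (\<Theta> z) * e z"
    and \<rho>: "\<rho> \<longlonglongrightarrow> 1" "\<And>k. 0 \<le> \<rho> k" "\<And>k. \<rho> k < (1 :: real)"
    and small: "\<And>\<epsilon>. 0 < \<epsilon> \<Longrightarrow> \<exists>\<delta>>0. \<exists>\<^sub>F k in sequentially.
      (\<integral>\<^sup>+t. log_deficit \<delta> (cmod (f (of_real (\<rho> k) * t))) \<partial>circle_measure) < ennreal \<epsilon>"
    and \<epsilon>: "0 < \<epsilon>"
  shows "\<exists>k. (\<integral>\<^sup>+t. log_deficit 1 (cmod (det (\<Theta> (of_real (\<rho> k) * t)))) \<partial>circle_measure) \<le> ennreal \<epsilon>"
proof -
  obtain C w where C: "cmod C = 1" and w: "integrable circle_measure (\<lambda>t. ln (w t))"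
    and ez: "\<And>z. z \<in> unit_disc \<Longrightarrow>
      e z = C * exp (LINT t|circle_measure. (t + z) / (t - z) * of_real (ln (w t)))"
    using e(1) unfolding scalar_outer_def by blast
  have e_pos: "0 < cmod (e z)" if "z \<in> unit_disc" for z
    using C by (simp add: ez[OF that] norm_mult)
  have disc: "of_real (\<rho> k) * t \<in> unit_disc" if "t \<in> unit_circle" for k t
    using that \<rho>(2,3)[of k] by (simp add: norm_mult)
  have meas\<Theta> [measurable]: "(\<lambda>t. det (\<Theta> (of_real (\<rho> k) * t))) \<in> borel_measurable circle_measure" for k
    using \<Theta> by (intro borel_measurable_circle_measure \<rho>
        continuous_on_circle_dilation[where R = 1, OF holomorphic_on_imp_continuous_on[OF holomorphic_on_det]])
      (auto simp: inner_class_def)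
  have mease [measurable]: "(\<lambda>t. e (of_real (\<rho> k) * t)) \<in> borel_measurable circle_measure" for k
    by (intro borel_measurable_circle_measure \<rho>
        continuous_on_circle_dilation[where R = 1, OF holomorphic_on_imp_continuous_on[OF e(2)]])
  have [measurable]: "(\<lambda>t. f (of_real (\<rho> k) * t)) \<in> borel_measurable circle_measure" for k
    by (subst measurable_cong[where g = "\<lambda>t. det (\<Theta> (of_real (\<rho> k) * t)) * e (of_real (\<rho> k) * t)"])
      (use f disc in \<open>auto intro!: borel_measurable_times meas\<Theta> mease\<close>)
  have "0 < \<epsilon> / 3" using \<epsilon> by simp
  from small[OF this] obtain \<delta> where \<delta>: "0 < \<delta>"
    and freq: "\<exists>\<^sub>F k in sequentially.
      (\<integral>\<^sup>+t. log_deficit \<delta> (cmod (f (of_real (\<rho> k) * t))) \<partial>circle_measure) < ennreal (\<epsilon> / 3)"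
    by blast
  have "\<forall>\<^sub>F n in sequentially.
      (\<integral>\<^sup>+s. ennreal (ln (w s) - (ln \<delta> + real n)) \<partial>circle_measure) < ennreal (\<epsilon> / 3)"
    using nn_integral_excess_tendsto_0[OF finite_measure_circle_measure w] \<epsilon>
    by (intro order_tendstoD) auto
  then obtain n where n: "(\<integral>\<^sup>+s. ennreal (ln (w s) - (ln \<delta> + real n)) \<partial>circle_measure) < ennreal (\<epsilon> / 3)"
    unfolding eventually_sequentially by blast
  have "\<forall>\<^sub>F k in sequentially. (\<integral>\<^sup>+t. min (log_deficit 1 (cmod (det (\<Theta> (of_real (\<rho> k) * t)))))
      (ennreal (real n)) \<partial>circle_measure) < ennreal (\<epsilon> / 3)"
    using inner_log_deficit_tendsto_0[OF \<Theta> \<rho>] \<epsilon> by (intro order_tendstoD) auto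
  from frequently_eventually_frequently[OF freq this]
  obtain k where k: "(\<integral>\<^sup>+t. log_deficit \<delta> (cmod (f (of_real (\<rho> k) * t))) \<partial>circle_measure) < ennreal (\<epsilon> / 3)"
    "(\<integral>\<^sup>+t. min (log_deficit 1 (cmod (det (\<Theta> (of_real (\<rho> k) * t))))) (ennreal (real n)) \<partial>circle_measure)
      < ennreal (\<epsilon> / 3)"
    by (auto dest!: frequently_ex)
  let ?\<theta> = "\<lambda>t. cmod (det (\<Theta> (of_real (\<rho> k) * t)))"
  let ?f = "\<lambda>t. log_deficit \<delta> (cmod (f (of_real (\<rho> k) * t)))"
  let ?e = "\<lambda>t. ennreal (ln (cmod (e (of_real (\<rho> k) * t))) - (ln \<delta> + real n))"
  have "(\<integral>\<^sup>+t. log_deficit 1 (?\<theta> t) \<partial>circle_measure)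
      \<le> (\<integral>\<^sup>+t. min (log_deficit 1 (?\<theta> t)) (ennreal (real n)) + (?f t + ?e t) \<partial>circle_measure)"
    using \<delta> disc f e_pos by (intro nn_integral_mono log_deficit_inner_le) (auto simp: norm_mult)
  also have "\<dots> = (\<integral>\<^sup>+t. min (log_deficit 1 (?\<theta> t)) (ennreal (real n)) \<partial>circle_measure) +
      ((\<integral>\<^sup>+t. ?f t \<partial>circle_measure) + (\<integral>\<^sup>+t. ?e t \<partial>circle_measure))"
    by (subst nn_integral_add; (subst nn_integral_add)?) measurable
  also have "\<dots> \<le> ennreal (\<epsilon> / 3) + (ennreal (\<epsilon> / 3) + ennreal (\<epsilon> / 3))"
    using k n nn_integral_ln_outer_le[where M = "ln \<delta> + real n", OF C w ez \<rho>(2)[of k] \<rho>(3)[of k]]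
    by (intro add_mono) (auto intro: less_imp_le)
  also have "\<dots> = ennreal \<epsilon>" using \<epsilon> by (simp flip: ennreal_plus)
  finally show ?thesis by blast
qed

text \<open>An exceptional \<open>c\<close> is in particular an eigenvalue of \<open>F 0\<close>;
  there are finitely many of these, and points carry no mass.\<close>

lemma AE_nonexceptional:
  fixes F :: "complex \<Rightarrow> complex ^ 'n ^ 'n"
  assumes "\<And>\<xi>. AE c in \<nu>. c \<noteq> \<xi>"
  shows "AE c in \<nu>. c \<notin> exceptional_set F"
proof -
  obtain M where M: "\<And>c. det (F 0 - mat c) = (\<Prod>x\<in>#M. x - c)"
    using det_shift_factorization[of "F 0"] by blast
  have "AE c in \<nu>. \<forall>x\<in>set_mset M. c \<noteq> x"
    by (intro AE_finite_allI assms) simp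
  then show ?thesis
  proof eventually_elim
    case (elim c)
    then have "det (shifted F c 0) \<noteq> 0"
      by (auto simp: shifted_def M prod_mset_zero_iff)
    then show ?case unfolding exceptional_set_def by auto
  qed
qed

theorem theorem6p1:
  fixes F :: "complex \<Rightarrow> complex ^ 'n ^ 'n"
    and \<Theta> E :: "complex \<Rightarrow> complex \<Rightarrow> complex ^ 'n ^ 'n"
    and K :: "complex set"
  assumes "F \<in> smirnov_class"
    and "\<And>c. c \<notin> exceptional_set F \<Longrightarrow> \<Theta> c \<in> inner_class"
    and "\<And>c. c \<notin> exceptional_set F \<Longrightarrow> E c \<in> outer_class"
    and "\<And>c z. c \<notin> exceptional_set F \<Longrightarrow> z \<in> unit_disc \<Longrightarrow> shifted F c z = \<Theta> c z ** E c z"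
    and "bounded K"
    and "K \<in> sets borel"
    and "positive_log_capacity K"
  shows "\<exists>c \<in> K \<inter> (- exceptional_set F). blaschke_potapov (\<Theta> c)"
proof -
  obtain \<nu> :: "complex measure" where \<nu>: "sets \<nu> = sets borel" "finite_measure \<nu>"
    "emeasure \<nu> UNIV \<noteq> 0" "emeasure \<nu> (- K) = 0" "\<And>\<xi>. finite_log_potential_at \<nu> \<xi>"
    "continuous_on UNIV (log_potential \<nu>)"
    using assms(7) unfolding positive_log_capacity_def by blast
  interpret continuous_potential \<nu> K
    by (rule continuous_potential.intro) (fact \<nu> assms)+
  \<comment> \<open>A sequence of radii replaces the continuous parameter, since Fatou's lemma and
    dominated convergence are sequential.\<close>
  define \<rho> where "\<rho> k = 1 - 1 / real (Suc k)" for k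
  have \<rho>: "\<And>k. 0 \<le> \<rho> k" "\<And>k. \<rho> k < 1" by (simp_all add: \<rho>_def)
  have "\<rho> \<longlonglongrightarrow> 1 - 0"
    unfolding \<rho>_def by (intro tendsto_diff tendsto_const LIMSEQ_Suc[OF lim_1_over_n])
  then have \<rho>1: "\<rho> \<longlonglongrightarrow> 1" by simp
  have F: "matrix_holomorphic_on F unit_disc" using assms(1) by (simp add: smirnov_class_def)
  have "\<exists>c. c \<in> K \<and> c \<notin> exceptional_set F \<and> (\<forall>e>0. \<exists>\<delta>>0. \<exists>\<^sub>F k in sequentially.
    (\<integral>\<^sup>+t. log_deficit \<delta> (cmod (det (F (of_real (\<rho> k) * t) - mat c))) \<partial>circle_measure) < ennreal e)"
    (is "\<exists>c. ?Q c")
  proof (rule ccontr)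
    \<comment> \<open>A property that holds almost everywhere would fail everywhere, which is
      impossible for a nonzero measure.\<close>
    assume "\<not> (\<exists>c. ?Q c)"
    moreover have "AE c in \<nu>. ?Q c"
      using AE_in_K AE_nonexceptional[OF AE_neq, of F] AE_small_log_deficit[where \<rho> = \<rho>, OF F \<rho>]
      by eventually_elim blast
    ultimately have "AE c in \<nu>. False" by (elim AE_mp) (intro AE_I2, blast)
    then obtain N where "{c \<in> space \<nu>. \<not> False} \<subseteq> N" "emeasure \<nu> N = 0" by (rule AE_E)
    moreover from this have "N = UNIV" by auto
    ultimately show False using \<nu>(3) by simp
  qed
  then obtain c where c: "c \<in> K" "c \<notin> exceptional_set F"
    and small: "\<And>e. 0 < e \<Longrightarrow> \<exists>\<delta>>0. \<exists>\<^sub>F k in sequentially.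
      (\<integral>\<^sup>+t. log_deficit \<delta> (cmod (det (shifted F c (of_real (\<rho> k) * t)))) \<partial>circle_measure) < ennreal e"
    unfolding shifted_def by blast
  have \<Theta>: "\<Theta> c \<in> inner_class" and e: "scalar_outer (\<lambda>z. det (E c z))"
    and hol: "(\<lambda>z. det (E c z)) holomorphic_on unit_disc"
    using assms(2,3) c(2) by (auto simp: outer_class_def smirnov_class_def intro!: holomorphic_on_det)
  have f: "det (shifted F c z) = det (\<Theta> c z) * det (E c z)" if "z \<in> unit_disc" for z
    by (simp add: assms(4)[OF c(2) that] det_mul)
  obtain z where z: "z \<in> unit_disc" "det (shifted F c z) \<noteq> 0"
    using c(2) unfolding exceptional_set_def by blast
  have "right_blaschke_potapov (\<Theta> c)"
  proof (rule schur_class_blaschke_potapov)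
    show "\<Theta> c \<in> schur_class" by (rule inner_class_schur_class[OF \<Theta>])
    show "cmod z < 1" "det (\<Theta> c z) \<noteq> 0" using z f by auto
    fix \<epsilon> :: real assume "0 < \<epsilon>"
    from inner_outer_small_log_deficit[OF \<Theta> e hol f \<rho>1 \<rho> small this]
    show "\<exists>r. 0 \<le> r \<and> r < 1 \<and>
        (\<integral>\<^sup>+t. log_deficit 1 (cmod (det (\<Theta> c (of_real r * t)))) \<partial>circle_measure) \<le> ennreal \<epsilon>"
      using \<rho> by blast
  qed
  then show ?thesis using c unfolding blaschke_potapov_def by blast
qed

end
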